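(* In the streaming PCA setting, consider the Krasulina–Oja iterates and $L_t:=\sin^2(\hat{\bm v}_t,\bm v_1)$. Let $\delta\in(0,1)$ and suppose $\mathbb P(L_0\le1/4)\ge1-\delta^3$. Define $L:=\max\{\lceil128B^4\log(\delta^{-1})^2/\rho^2\rceil;32\}$ and choose the step sizes $\eta_t=\frac{2}{\rho(t+L)}$. Then with probability at least $1-2(e+1)\delta$, uniformly over all $t\ge0$, $$L_t\le\max\Big\{\frac{252L}{\log(\delta^{-1})};\frac{1008B^4}{\rho^2}\Big\}\cdot\frac{\log(\delta^{-1})+2\log\log(t+9)}{t+L}.$$
   Context: Streaming PCA setting: $\bm X_1,\bm X_2,\dots\in\mathbb R^p$ are i.i.d. centered random vectors with covariance matrix $\bm\Sigma$, and $\|\bm X_i\|\le B$ almost surely. The eigenvalues of $\bm\Sigma$ in decreasing order are $\lambda_1>\lambda_2\ge\dots\ge\lambda_p$, $\bm v_1$ is a unit eigenvector for $\lambda_1$, and $\rho:=\lambda_1-\lambda_2$ is the eigengap. $\hat{\bm v}_0$ is a random unit vector independent of $(\bm X_t)$. $\{\eta_t\}_{t\ge1}$ are deterministic positive step sizes. Krasulina–Oja update: with $y_t:=\bm X_t^\top\hat{\bm v}_{t-1}$, $\hat{\bm v}_t=\hat{\bm v}_{t-1}+\eta_t\,y_t\big[\bm X_t-\frac{y_t}{\|\hat{\bm v}_{t-1}\|^2}\hat{\bm v}_{t-1}\big]$. For non-zero $\bm x,\bm y$, $\sin^2(\bm x,\bm y):=1-\frac{\langle\bm x,\bm y\rangle^2}{\|\bm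 x\|^2\|\bm y\|^2}$. $\mathcal F_t:=\sigma(\hat{\bm v}_0,\bm X_1,\dots,\bm X_t)$. *)

theory Defs
  imports "HOL-Probability.Probability"
begin

definition eigvals :: "real^'n^'n \<Rightarrow> real set" where
  "eigvals A = {\<mu>. \<exists>x. x \<noteq> 0 \<and> A *v x = \<mu> *\<^sub>R x}"

definition eigspace :: "real^'n^'n \<Rightarrow> real \<Rightarrow> (real^'n) set" where
  "eigspace A \<mu> = {x. A *v x = \<mu> *\<^sub>R x}"

definition lambda1 :: "real^'n^'n \<Rightarrow> real" where
  "lambda1 A = Max (eigvals A)"

text \<open>Second largest eigenvalue lambda_2 in the list of eigenvalues in decreasing order,
  counted with multiplicity (for symmetric A geometric = algebraic multiplicity):
  if lambda_1 has multiplicity at least 2 then lambda_2 = lambda_1.\<close>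
definition lambda2 :: "real^'n^'n \<Rightarrow> real" where
  "lambda2 A = (if dim (eigspace A (lambda1 A)) \<ge> 2 then lambda1 A
                else Max (eigvals A - {lambda1 A}))"

text \<open>Covariance matrix of a centered random vector Y: entries E[Y_i Y_j].\<close>
definition cov_matrix :: "'a measure \<Rightarrow> ('a \<Rightarrow> real^'n) \<Rightarrow> real^'n^'n" where
  "cov_matrix M Y = (\<chi> i j. integral\<^sup>L M (\<lambda>\<omega>. Y \<omega> $ i * Y \<omega> $ j))"

definition sin2 :: "real^'n \<Rightarrow> real^'n \<Rightarrow> real" where
  "sin2 x y = 1 - (x \<bullet> y)^2 / ((norm x)^2 * (norm y)^2)"

text \<open>Krasulina--Oja iterates along a sample path: step sizes eta, data xs (xs t = X_t, t \<ge> 1),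
  initial vector v0.\<close>
fun kooja :: "(nat \<Rightarrow> real) \<Rightarrow> (nat \<Rightarrow> real^'n) \<Rightarrow> real^'n \<Rightarrow> nat \<Rightarrow> real^'n" where
  "kooja eta xs v0 0 = v0"
| "kooja eta xs v0 (Suc t) =
     (let v = kooja eta xs v0 t; x = xs (Suc t); y = x \<bullet> v
      in v + (eta (Suc t) * y) *\<^sub>R (x - (y / (norm v)^2) *\<^sub>R v))"

end

theory Submission
  imports Defs
begin

text \<open>
  Write T(t) = t + Lc, b = B^4 / rho^2 and l = log (1/delta). One update obeys
  L(t) \<le> L(t-1) - 2 eta c y z + eta^2 B^4 / 4 pathwise, where c = u \<bullet> v1, y = x \<bullet> u and
  z = x \<bullet> v1 - y c for the normalised iterate u. The eigengap gives 2 c y z a mean of at least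
  rho L(t-1) as long as L(t-1) \<le> 1/2, and its range is only of order sqrt (L(t-1)) B^2, so by
  Hoeffding's lemma the exponential moment of theta L(t) is governed by the factor
  1 - 2/T + 2 theta b / T^2 on L(t-1). For a horizon H the weights
  theta(t) = T(t) sqrt (T(t)/H) / (4b) therefore turn
  exp (theta(t) L(t) - sqrt (T(t)/H) / 2) into a supermartingale while L \<le> 1/2 and T \<le> H, and the
  exponent 3/2 > 1 keeps the accumulated variance bounded instead of logarithmic in t.
  Ville's inequality at the horizons H = 4^(k+1) Lc with failure probabilities delta / (k+1)^2
  yields the iterated-logarithm rate. Absence of crossings up to time t itself implies
  L(t) \<le> 1/2, so the localisation to L \<le> 1/2 costs nothing.
\<close>

subsection \<open>Quadratic forms and the eigengap\<close>

text \<open>A maximiser of the Rayleigh quotient on the unit sphere of \<open>S\<close> is an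
  eigenvector, since otherwise moving it along its residual \<open>r\<close> would raise the
  quotient; invariance of \<open>S\<close> keeps \<open>r\<close> in \<open>S\<close>. The lemma
  will be applied to the orthogonal complement of \<open>v1\<close>.\<close>

lemma symmetric_form_max_eigenvector:
  fixes A :: "real^'n^'n" and S :: "(real^'n) set"
  assumes sym: "\<And>x y. (A *v x) \<bullet> y = x \<bullet> (A *v y)"
    and S: "subspace S" "\<And>x. x \<in> S \<Longrightarrow> A *v x \<in> S" "\<exists>x\<in>S. x \<noteq> 0"
  obtains \<mu> w where "w \<in> S" "norm w = 1" "A *v w = \<mu> *\<^sub>R w"
    "\<And>x. x \<in> S \<Longrightarrow> x \<bullet> (A *v x) \<le> \<mu> * (x \<bullet> x)"
proof -
  have "compact (S \<inter> sphere 0 1)"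
    using closed_subspace[OF S(1)] by (simp add: closed_Int_compact)
  moreover have normalized: "x /\<^sub>R norm x \<in> S \<inter> sphere 0 1" if "x \<in> S" "x \<noteq> 0" for x
    using that S(1) by (auto simp: subspace_scale)
  then have "S \<inter> sphere 0 1 \<noteq> {}" using S(3) by blast
  moreover have "continuous_on (S \<inter> sphere 0 1) (\<lambda>x. x \<bullet> (A *v x))"
    by (intro continuous_intros linear_continuous_on matrix_vector_mul_bounded_linear)
  ultimately obtain w where w: "w \<in> S \<inter> sphere 0 1"
    and wmax: "\<And>x. x \<in> S \<inter> sphere 0 1 \<Longrightarrow> x \<bullet> (A *v x) \<le> w \<bullet> (A *v w)"
    using continuous_attains_sup[of "S \<inter> sphere 0 1" "\<lambda>x. x \<bullet> (A *v x)"] by blast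
  define \<mu> where "\<mu> = w \<bullet> (A *v w)"
  have ww: "w \<bullet> w = 1" using w by (simp add: norm_eq_1)
  have le: "x \<bullet> (A *v x) \<le> \<mu> * (x \<bullet> x)" if "x \<in> S" for x
  proof (cases "x = 0")
    case False
    have "(x /\<^sub>R norm x) \<bullet> (A *v (x /\<^sub>R norm x)) = x \<bullet> (A *v x) / (x \<bullet> x)"
      by (simp add: matrix_vector_mult_scaleR dot_square_norm power2_eq_square field_simps)
    with wmax[OF normalized[OF that False]] False show ?thesis
      by (simp add: \<mu>_def pos_divide_le_eq)
  qed simp
  define r where "r = \<mu> *\<^sub>R w - A *v w"
  define q where "q = \<mu> * (r \<bullet> r) - r \<bullet> (A *v r)"
  have rS: "r \<in> S" unfolding r_def using w S by (auto intro!: subspace_diff subspace_scale)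
  have q0: "q \<ge> 0" using le[OF rS] by (simp add: q_def)
  \<comment> \<open>Optimality of \<open>w\<close> against \<open>w - e *\<^sub>R r\<close> bounds
    the first-order gain by a second-order term in \<open>e\<close>. Small \<open>e\<close> then
    forces \<open>r = 0\<close>.\<close>
  have perturb: "2 * (r \<bullet> r) \<le> e * q" if "e > 0" for e :: real
  proof -
    have "w - e *\<^sub>R r \<in> S" using rS w S(1) by (auto intro!: subspace_diff subspace_scale)
    note step = le[OF this]
    have lhs: "(w - e *\<^sub>R r) \<bullet> (A *v (w - e *\<^sub>R r))
        = \<mu> - 2 * e * (r \<bullet> (A *v w)) + e^2 * (r \<bullet> (A *v r))"
      using sym[of w r]
      by (simp add: matrix_vector_mult_diff_distrib matrix_vector_mult_scaleR inner_diff
          \<mu>_def power2_eq_square algebra_simps inner_commute)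
    have rhs: "(w - e *\<^sub>R r) \<bullet> (w - e *\<^sub>R r) = 1 - 2 * e * (r \<bullet> w) + e^2 * (r \<bullet> r)"
      using ww by (simp add: inner_diff power2_eq_square algebra_simps inner_commute)
    have rr: "r \<bullet> r = \<mu> * (r \<bullet> w) - r \<bullet> (A *v w)"
      by (subst (2) r_def) (simp add: inner_diff)
    have "e * (2 * (r \<bullet> r)) = 2 * e * (\<mu> * (r \<bullet> w) - r \<bullet> (A *v w))"
      by (subst rr) simp
    also have "\<dots> \<le> e * (e * q)"
      using step unfolding lhs rhs q_def by (simp add: algebra_simps power2_eq_square)
    finally have "e * (2 * (r \<bullet> r)) \<le> e * (e * q)" .
    with that show ?thesis by simp
  qed
  have "r = 0"
  proof (rule ccontr)
    assume "r \<noteq> 0"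
    then have rr: "r \<bullet> r > 0" by simp
    \<comment> \<open>This \<open>e\<close> turns the bound into the factor
      \<open>q / (q + 1)\<close>, which is at most 1; the summand 1 covers
      \<open>q = 0\<close>.\<close>
    from perturb[of "(r \<bullet> r) / (q + 1)"] rr q0
    have "2 * (r \<bullet> r) \<le> (r \<bullet> r) * (q / (q + 1))" by simp
    also have "\<dots> \<le> (r \<bullet> r) * 1"
      using q0 rr by (intro mult_left_mono) (auto simp: field_simps)
    finally show False using rr by simp
  qed
  then have "A *v w = \<mu> *\<^sub>R w" by (simp add: r_def)
  with that[of w \<mu>] le w show ?thesis by auto
qed

text \<open>Eigenvectors of a symmetric matrix for distinct eigenvalues are orthogonal, hence
  independent. Finiteness is what makes the \<open>Max\<close> in \<open>lambda2\<close> an upper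
  bound.\<close>

lemma finite_eigvals_symmetric:
  fixes A :: "real^'n^'n"
  assumes sym: "\<And>x y. (A *v x) \<bullet> y = x \<bullet> (A *v y)"
  shows "finite (eigvals A)"
proof -
  have "\<forall>\<mu>\<in>eigvals A. \<exists>x. x \<noteq> 0 \<and> A *v x = \<mu> *\<^sub>R x"
    by (auto simp: eigvals_def)
  from bchoice[OF this]
  obtain e where e: "\<And>\<mu>. \<mu> \<in> eigvals A \<Longrightarrow> e \<mu> \<noteq> 0 \<and> A *v e \<mu> = \<mu> *\<^sub>R e \<mu>"
    by blast
  have orth: "e \<mu> \<bullet> e \<nu> = 0" if "\<mu> \<in> eigvals A" "\<nu> \<in> eigvals A" "\<mu> \<noteq> \<nu>" for \<mu> \<nu>
    using sym[of "e \<mu>" "e \<nu>"] e that by auto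
  have inj: "inj_on e (eigvals A)"
    by (rule inj_onI, rule ccontr) (use orth e in force)
  have "pairwise orthogonal (e ` eigvals A)"
    using orth by (auto simp: pairwise_def orthogonal_def)
  then have "independent (e ` eigvals A)"
    using e by (intro pairwise_orthogonal_independent) auto
  then show ?thesis
    using inj finite_imageD independent_bound by blast
qed

text \<open>The form restricted to the complement of \<open>v1\<close> is bounded by an eigenvalue
  \<open>\<mu>\<close> with an eigenvector in that complement, which is nontrivial in dimension at
  least 2. Once \<open>\<mu>\<close> differs from \<open>lambda1 A\<close>, it belongs to the set
  whose maximum is \<open>lambda2 A\<close>.\<close>

lemma quadratic_form_le_lambda2:
  fixes A :: "real^'n^'n" and v1 :: "real^'n"
  assumes sym: "\<And>x y. (A *v x) \<bullet> y = x \<bullet> (A *v y)"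
    and dimp: "CARD('n) \<ge> 2"
    and gap: "lambda2 A < lambda1 A"
    and v1: "norm v1 = 1" "A *v v1 = lambda1 A *\<^sub>R v1"
    and x: "x \<bullet> v1 = 0"
  shows "x \<bullet> (A *v x) \<le> lambda2 A * (x \<bullet> x)"
proof -
  have v1n: "v1 \<noteq> 0" using v1(1) by auto
  define S where "S = {x. x \<bullet> v1 = 0}"
  have S: "subspace S" "\<And>x. x \<in> S \<Longrightarrow> A *v x \<in> S"
    unfolding S_def subspace_def using sym v1(2) by (auto simp: inner_add_left)
  have "\<exists>x\<in>S. x \<noteq> 0"
  proof -
    have "DIM(real^'n) \<noteq> dim {v1}" using dimp by (simp add: dim_singleton)
    then have "span {v1} \<noteq> UNIV" by (metis dim_UNIV dim_span)
    then obtain a where "a \<noteq> 0" "\<And>y. y \<in> span {v1} \<Longrightarrow> a \<bullet> y = 0"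
      using span_not_UNIV_orthogonal[of "{v1}"] by blast
    then show ?thesis unfolding S_def by (auto intro!: exI[of _ a] simp: span_base)
  qed
  from symmetric_form_max_eigenvector[OF sym S this]
  obtain \<mu> w where w: "w \<in> S" "norm w = 1" "A *v w = \<mu> *\<^sub>R w"
    and max: "\<And>x. x \<in> S \<Longrightarrow> x \<bullet> (A *v x) \<le> \<mu> * (x \<bullet> x)" by blast
  have lt2: "\<not> dim (eigspace A (lambda1 A)) \<ge> 2"
    using gap by (auto simp: lambda2_def)
  have wn: "w \<noteq> 0" using w(2) by auto
  \<comment> \<open>Otherwise \<open>v1\<close> and \<open>w\<close> span a plane in the top
    eigenspace, and the definition of \<open>lambda2\<close> would close the gap.\<close>
  have "\<mu> \<noteq> lambda1 A"
  proof
    assume "\<mu> = lambda1 A"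
    then have "{v1, w} \<subseteq> eigspace A (lambda1 A)" using w v1 by (auto simp: eigspace_def)
    moreover have "pairwise orthogonal {v1, w}"
      using w(1) by (auto simp: pairwise_def orthogonal_def S_def inner_commute)
    then have "independent {v1, w}"
      using v1n wn by (intro pairwise_orthogonal_independent) auto
    moreover have "v1 \<noteq> w" using w(1) v1n by (auto simp: S_def)
    then have "card {v1, w} = 2" by simp
    ultimately have "2 \<le> dim (eigspace A (lambda1 A))"
      by (metis independent_card_le_dim)
    with lt2 show False by simp
  qed
  moreover have "\<mu> \<in> eigvals A" using w wn by (auto simp: eigvals_def)
  ultimately have "\<mu> \<le> lambda2 A"
    using lt2 finite_eigvals_symmetric[OF sym] by (auto simp: lambda2_def)
  moreover have "x \<bullet> (A *v x) \<le> \<mu> * (x \<bullet> x)" using max x by (simp add: S_def)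
  ultimately show ?thesis
    by (meson inner_ge_zero mult_right_mono order_trans)
qed

text \<open>Split \<open>u\<close> into its component along \<open>v1\<close> and an orthogonal rest
  \<open>w\<close>. The cross terms of the form vanish because \<open>v1\<close> is an eigenvector,
  and the bound by \<open>lambda2\<close> applies to \<open>w\<close>.\<close>

lemma quadratic_form_gap:
  fixes A :: "real^'n^'n" and u v1 :: "real^'n"
  assumes sym: "\<And>x y. (A *v x) \<bullet> y = x \<bullet> (A *v y)"
    and dimp: "CARD('n) \<ge> 2"
    and gap: "lambda2 A < lambda1 A"
    and v1: "norm v1 = 1" "A *v v1 = lambda1 A *\<^sub>R v1"
    and u: "norm u = 1"
  shows "(lambda1 A - lambda2 A) * (1 - (u \<bullet> v1)^2) \<le> lambda1 A - u \<bullet> (A *v u)"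
proof -
  define c where "c = u \<bullet> v1"
  define w where "w = u - c *\<^sub>R v1"
  have uu: "u \<bullet> u = 1" and vv: "v1 \<bullet> v1 = 1" using u v1 by (simp_all add: norm_eq_1)
  have wv: "w \<bullet> v1 = 0" by (simp add: w_def inner_diff vv c_def)
  have ww: "w \<bullet> w = 1 - c^2"
    by (simp add: w_def inner_diff uu vv power2_eq_square inner_commute) (simp add: c_def inner_commute)
  have ueq: "u = c *\<^sub>R v1 + w" by (simp add: w_def)
  have "v1 \<bullet> (A *v w) = 0" using sym[of v1 w] v1(2) wv by (simp add: inner_commute)
  then have "u \<bullet> (A *v u) = c^2 * lambda1 A + w \<bullet> (A *v w)"
    using wv vv v1(2)
    by (subst (1 2) ueq) (simp add: matrix_vector_right_distrib matrix_vector_mult_scaleR inner_add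
        power2_eq_square inner_commute)
  also have "\<dots> \<le> c^2 * lambda1 A + lambda2 A * (1 - c^2)"
    using quadratic_form_le_lambda2[OF sym dimp gap v1 wv] ww by simp
  finally show ?thesis by (simp add: c_def algebra_simps)
qed

subsection \<open>One Krasulina--Oja step\<close>

text \<open>A single update as a function of sample and current vector, so that it can be integrated
  over the law of the sample with the vector held fixed.\<close>

definition oja_step :: "real \<Rightarrow> real^'n \<Rightarrow> real^'n \<Rightarrow> real^'n" where
  "oja_step h x v = v + (h * (x \<bullet> v)) *\<^sub>R (x - ((x \<bullet> v) / (norm v)^2) *\<^sub>R v)"

lemma kooja_Suc: "kooja eta xs v0 (Suc t) = oja_step (eta (Suc t)) (xs (Suc t)) (kooja eta xs v0 t)"
  by (simp add: oja_step_def Let_def)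

text \<open>Index 0 is left free because the initial vector is a separate argument. This covers both
  the truncation of a stream after time \<open>t\<close> and the change of its entry 0 to the
  initial vector.\<close>

lemma kooja_cong:
  assumes "\<And>s. 1 \<le> s \<Longrightarrow> s \<le> t \<Longrightarrow> xs s = ys s"
  shows "kooja eta xs v t = kooja eta ys v t"
  using assms by (induction t) (simp_all only: kooja.simps kooja_Suc le_Suc_eq, auto simp: kooja_Suc simp del: kooja.simps(2))

lemma sin2_scaleR: "k \<noteq> 0 \<Longrightarrow> sin2 (k *\<^sub>R x) y = sin2 x y"
  by (simp add: sin2_def power_mult_distrib)

lemma sin2_unit: "norm u = 1 \<Longrightarrow> norm v = 1 \<Longrightarrow> sin2 u v = 1 - (u \<bullet> v)^2"
  by (simp add: sin2_def)

lemma sin2_nonneg: "0 \<le> sin2 x y"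
proof -
  have "(x \<bullet> y)^2 \<le> (norm x)^2 * (norm y)^2"
    using Cauchy_Schwarz_ineq[of x y] by (simp add: power2_norm_eq_inner)
  then show ?thesis
    by (auto simp: sin2_def divide_le_eq_1 not_less power_mult_distrib[symmetric])
qed

text \<open>The step is homogeneous in \<open>v\<close> and \<open>sin2\<close> is scale invariant,
  so the one-step analysis may assume a unit vector.\<close>

lemma oja_step_normalize:
  assumes "v \<noteq> 0"
  shows "oja_step h x v = norm v *\<^sub>R oja_step h x (v /\<^sub>R norm v)"
  using assms by (simp add: oja_step_def scaleR_add_right scaleR_diff_right power2_eq_square field_simps)

text \<open>The increment is orthogonal to \<open>u\<close>, so the squared norm of the new vector
  is \<open>1 + s\<close> with \<open>s\<close> of second order in \<open>h\<close>. Replacing the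
  quotient by its first-order part costs at most \<open>s\<close>.\<close>

lemma sin2_oja_step_unit_le:
  fixes u v1 x :: "real^'n"
  assumes u: "norm u = 1" and v1: "norm v1 = 1"
  defines "c \<equiv> u \<bullet> v1" and "y \<equiv> x \<bullet> u"
  shows "sin2 (oja_step h x u) v1 \<le> 1 - c^2 - h * (2 * c * y * (x \<bullet> v1 - y * c)) + h^2 * norm x^4 / 4"
proof -
  have uu: "u \<bullet> u = 1" and vv: "v1 \<bullet> v1 = 1" using u v1 by (simp_all add: norm_eq_1)
  define p where "p = x - y *\<^sub>R u"
  define g where "g = oja_step h x u"
  have g: "g = u + (h * y) *\<^sub>R p" by (simp add: g_def oja_step_def p_def y_def u)
  have pu: "p \<bullet> u = 0" by (simp add: p_def inner_diff uu y_def)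
  have pp: "p \<bullet> p = norm x^2 - y^2"
    by (simp add: p_def inner_diff uu power2_norm_eq_inner power2_eq_square inner_commute)
       (simp add: y_def inner_commute[of u x] dot_square_norm power2_eq_square)
  define s where "s = h^2 * y^2 * (norm x^2 - y^2)"
  define a where "a = h * y * (x \<bullet> v1 - y * c)"
  have gg: "g \<bullet> g = 1 + s"
    unfolding s_def pp[symmetric] using pu
    by (simp add: g inner_add uu power2_eq_square inner_commute)
  have gv: "g \<bullet> v1 = c + a"
    by (simp add: g inner_add p_def inner_diff c_def a_def algebra_simps)
  have s0: "0 \<le> s" unfolding s_def pp[symmetric] by simp
  have cs: "(c + a)^2 \<le> 1 + s"
    using Cauchy_Schwarz_ineq[of g v1] by (simp add: gg gv vv)
  have sin: "sin2 g v1 = 1 - (c + a)^2 / (1 + s)"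
    by (simp add: sin2_def power2_norm_eq_inner gg gv vv)
  \<comment> \<open>This is the target inequality with the denominator \<open>1 + s\<close> cleared;
    Cauchy-Schwarz in the form \<open>cs\<close> makes the bracket nonnegative.\<close>
  have "s * (1 + s - c^2 - 2 * c * a) + a^2 \<ge> 0"
  proof -
    have "1 + s - c^2 - 2 * c * a = (1 + s - (c + a)^2) + a^2"
      by (simp add: power2_eq_square algebra_simps)
    also have "\<dots> \<ge> 0" using cs zero_le_power2[of a] by linarith
    finally have "1 + s - c^2 - 2 * c * a \<ge> 0" .
    then show ?thesis using s0 by simp
  qed
  then have "1 - (c + a)^2 / (1 + s) \<le> 1 - c^2 - 2 * c * a + s"
    using s0 by (simp add: field_simps power2_eq_square)
  moreover have "s \<le> h^2 * norm x^4 / 4"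
  proof -
    \<comment> \<open>AM-GM for two numbers with sum \<open>norm x^2\<close>.\<close>
    have "y^2 * (norm x^2 - y^2) \<le> norm x^4 / 4"
      using zero_le_power2[of "norm x^2 / 2 - y^2"]
      by (simp add: power2_eq_square power4_eq_xxxx algebra_simps)
    then have "h^2 * (y^2 * (norm x^2 - y^2)) \<le> h^2 * (norm x^4 / 4)"
      by (rule mult_left_mono) simp
    then show ?thesis by (simp add: s_def)
  qed
  ultimately show ?thesis unfolding g_def[symmetric] sin by (simp add: a_def algebra_simps)
qed

text \<open>With \<open>p\<close> and \<open>r\<close> the components of \<open>x\<close> and
  \<open>v1\<close> orthogonal to \<open>u\<close>, the last factor is \<open>p \<bullet> r\<close>.
  Here \<open>norm r\<close> supplies the square root, and AM-GM bounds
  \<open>2 * \<bar>y\<bar> * norm p\<close>. The square root is essential: it makes the variance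
  proxy proportional to the current error.\<close>

lemma oja_noise_bound:
  fixes u v1 x :: "real^'n"
  assumes u: "norm u = 1" and v1: "norm v1 = 1"
  defines "c \<equiv> u \<bullet> v1" and "y \<equiv> x \<bullet> u"
  shows "\<bar>2 * c * y * (x \<bullet> v1 - y * c)\<bar> \<le> sqrt (1 - c^2) * norm x^2"
proof -
  have uu: "u \<bullet> u = 1" and vv: "v1 \<bullet> v1 = 1" using u v1 by (simp_all add: norm_eq_1)
  define p where "p = x - y *\<^sub>R u"
  define r where "r = v1 - c *\<^sub>R u"
  have pu: "p \<bullet> u = 0" by (simp add: p_def inner_diff uu y_def)
  have pp: "p \<bullet> p = norm x^2 - y^2"
    by (simp add: p_def inner_diff uu power2_norm_eq_inner power2_eq_square inner_commute)
       (simp add: y_def inner_commute[of u x] dot_square_norm power2_eq_square)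
  have rr: "r \<bullet> r = 1 - c^2"
    by (simp add: r_def inner_diff uu vv power2_eq_square inner_commute) (simp add: c_def inner_commute)
  have z: "x \<bullet> v1 - y * c = p \<bullet> r"
    using pu by (simp add: r_def inner_diff) (simp add: p_def inner_diff c_def)
  have "\<bar>p \<bullet> r\<bar> \<le> norm p * norm r" by (rule Cauchy_Schwarz_ineq2)
  moreover have nr: "norm r = sqrt (1 - c^2)" by (simp add: norm_eq_sqrt_inner rr)
  moreover have "2 * \<bar>y\<bar> * norm p \<le> norm x^2"
  proof -
    have "(norm p)^2 = norm x^2 - y^2" using pp by (simp add: power2_norm_eq_inner)
    then show ?thesis using zero_le_power2[of "\<bar>y\<bar> - norm p"]
      by (simp add: power2_diff)
  qed
  moreover have "\<bar>c\<bar> \<le> 1" using Cauchy_Schwarz_ineq2[of u v1] u v1 by (simp add: c_def)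
  ultimately have "\<bar>c\<bar> * (2 * \<bar>y\<bar> * \<bar>p \<bullet> r\<bar>) \<le> 1 * (2 * \<bar>y\<bar> * (norm p * norm r))"
    by (intro mult_mono) auto
  also have "\<dots> = (2 * \<bar>y\<bar> * norm p) * norm r" by simp
  also have "\<dots> \<le> norm x^2 * norm r"
    by (rule mult_right_mono) (fact, simp)
  finally show ?thesis unfolding z nr by (simp add: abs_mult mult_ac)
qed

section \<open>Covariance as a bilinear form and the exponential moment of one step\<close>

lemma cov_matrix_symmetric: "(cov_matrix M Y *v x) \<bullet> y = x \<bullet> (cov_matrix M Y *v y)"
proof -
  have "transpose (cov_matrix M Y) = cov_matrix M Y"
    by (simp add: cov_matrix_def transpose_def vec_eq_iff mult.commute)
  then show ?thesis
    by (metis dot_lmul_matrix inner_commute transpose_matrix_vector)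
qed

lemma cov_matrix_distr:
  assumes [measurable]: "Y \<in> borel_measurable M"
  shows "cov_matrix (distr M borel Y) (\<lambda>x. x) = cov_matrix M Y"
  unfolding cov_matrix_def by (simp add: integral_distr)

lemma inner_cov_matrix:
  fixes D :: "(real^'n) measure"
  assumes D: "prob_space D" and sets: "sets D = sets borel"
    and bnd: "AE x in D. norm x \<le> B"
  shows "integrable D (\<lambda>x. (x \<bullet> u) * (x \<bullet> w))"
    and "(\<integral>x. (x \<bullet> u) * (x \<bullet> w) \<partial>D) = u \<bullet> (cov_matrix D (\<lambda>x. x) *v w)"
proof -
  interpret D: prob_space D by fact
  note [measurable_cong] = sets
  have int: "integrable D (\<lambda>x. (x \<bullet> u) * (x \<bullet> w))" for u w
  proof (rule D.integrable_const_bound[where B = "B^2 * norm u * norm w"])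
    show "AE x in D. norm ((x \<bullet> u) * (x \<bullet> w)) \<le> B^2 * norm u * norm w"
      using bnd
    proof eventually_elim
      case (elim x)
      have "\<bar>x \<bullet> u\<bar> * \<bar>x \<bullet> w\<bar> \<le> (B * norm u) * (B * norm w)"
        using Cauchy_Schwarz_ineq2[of x u] Cauchy_Schwarz_ineq2[of x w] elim
        by (intro mult_mono order_trans[OF Cauchy_Schwarz_ineq2] mult_right_mono)
           (auto intro!: mult_nonneg_nonneg order_trans[OF norm_ge_zero elim])
      then show ?case by (simp add: abs_mult power2_eq_square mult_ac)
    qed
  qed simp
  show "integrable D (\<lambda>x. (x \<bullet> u) * (x \<bullet> w))" by (rule int)
  have intij: "integrable D (\<lambda>x. x $ i * x $ j)" for i j
    using int[of "axis i 1" "axis j 1"] by (simp add: inner_axis)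
  have "(\<integral>x. (x \<bullet> u) * (x \<bullet> w) \<partial>D) = (\<integral>x. (\<Sum>i\<in>UNIV. \<Sum>j\<in>UNIV. u $ i * w $ j * (x $ i * x $ j)) \<partial>D)"
    by (intro Bochner_Integration.integral_cong) (auto simp: inner_vec_def sum_product mult_ac)
  also have "\<dots> = (\<Sum>i\<in>UNIV. \<Sum>j\<in>UNIV. u $ i * w $ j * (\<integral>x. x $ i * x $ j \<partial>D))"
    using intij by (simp add: integrable_sum)
  also have "\<dots> = u \<bullet> (cov_matrix D (\<lambda>x. x) *v w)"
    by (simp add: inner_vec_def cov_matrix_def matrix_vector_mult_def sum_distrib_left mult_ac)
  finally show "(\<integral>x. (x \<bullet> u) * (x \<bullet> w) \<partial>D) = u \<bullet> (cov_matrix D (\<lambda>x. x) *v w)" .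
qed

text \<open>The pathwise bound is linear in the noise term \<open>f\<close>. Its mean
  \<open>m\<close> contributes the contraction through the eigengap, and Hoeffding's lemma controls
  its fluctuation; both are proportional to the current error. Only the quadratic remainder is
  additive.\<close>

lemma exp_moment_oja_step:
  fixes D :: "(real^'n) measure" and v v1 :: "real^'n"
  defines "\<Sigma> \<equiv> cov_matrix D (\<lambda>x. x)"
  assumes D: "prob_space D" and sets: "sets D = sets borel"
    and bnd: "AE x in D. norm x \<le> B"
    and dimp: "CARD('n) \<ge> 2"
    and gap: "lambda2 \<Sigma> < lambda1 \<Sigma>"
    and v1: "norm v1 = 1" "\<Sigma> *v v1 = lambda1 \<Sigma> *\<^sub>R v1"
    and rho: "\<rho> = lambda1 \<Sigma> - lambda2 \<Sigma>"
    and pos: "0 < h" "0 < \<theta>"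
    and half: "sin2 v v1 \<le> 1/2"
  shows "(\<integral>\<^sup>+x. ennreal (exp (\<theta> * sin2 (oja_step h x v) v1)) \<partial>D)
    \<le> ennreal (exp (\<theta> * sin2 v v1 * (1 - h * \<rho> + \<theta> * h^2 * B^4 / 2) + \<theta> * h^2 * B^4 / 4))"
proof -
  interpret D: prob_space D by fact
  note [measurable_cong] = sets
  \<comment> \<open>Division by zero yields 0, so \<open>sin2 0 v1\<close> is 1 and
    \<open>half\<close> excludes it.\<close>
  have "v \<noteq> 0" using half by (auto simp: sin2_def)
  define u where "u = v /\<^sub>R norm v"
  have u: "norm u = 1" using \<open>v \<noteq> 0\<close> by (simp add: u_def)
  define c where "c = u \<bullet> v1"
  define S where "S = sin2 v v1"
  have Seq: "S = 1 - c^2"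
    using sin2_scaleR[of "inverse (norm v)" v v1] \<open>v \<noteq> 0\<close> sin2_unit[OF u v1(1)]
    by (simp add: S_def u_def[symmetric] c_def)
  have S0: "0 \<le> S" by (simp add: S_def sin2_nonneg)
  have step: "sin2 (oja_step h x v) v1 = sin2 (oja_step h x u) v1" for x
    using \<open>v \<noteq> 0\<close> sin2_scaleR[of "norm v" "oja_step h x u" v1] oja_step_normalize[of v h x]
    by (simp add: u_def)
  define f where "f x = - (2 * c * (x \<bullet> u) * (x \<bullet> v1 - (x \<bullet> u) * c))" for x
  have f_meas[measurable]: "f \<in> borel_measurable D" unfolding f_def by measurable
  have f_bound: "AE x in D. f x \<in> {- (sqrt S * B^2) .. sqrt S * B^2}"
    using bnd
  proof eventually_elim
    case (elim x)
    have "\<bar>f x\<bar> \<le> sqrt S * norm x^2"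
      using oja_noise_bound[OF u v1(1), of x] by (simp add: f_def Seq c_def)
    also have "\<dots> \<le> sqrt S * B^2"
      using elim S0 by (intro mult_left_mono power_mono) auto
    finally show ?case by (simp add: abs_le_iff minus_le_iff)
  qed
  \<comment> \<open>An interval of length \<open>2 * sqrt S * B^2\<close> gives Hoeffding's exponent
    the factor \<open>S * B^4 / 2\<close>.\<close>
  interpret interval_bounded_random_variable D f "- (sqrt S * B^2)" "sqrt S * B^2"
    using f_meas f_bound by unfold_locales
  define m where "m = (\<integral>x. f x \<partial>D)"
  have "m = - (2 * c * ((\<integral>x. (x \<bullet> u) * (x \<bullet> v1) \<partial>D) - c * (\<integral>x. (x \<bullet> u) * (x \<bullet> u) \<partial>D)))"
  proof -
    have "f = (\<lambda>x. (-2 * c) * ((x \<bullet> u) * (x \<bullet> v1)) + (2 * c * c) * ((x \<bullet> u) * (x \<bullet> u)))"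
      by (simp add: f_def fun_eq_iff algebra_simps)
    then have "m = (\<integral>x. (-2 * c) * ((x \<bullet> u) * (x \<bullet> v1)) + (2 * c * c) * ((x \<bullet> u) * (x \<bullet> u)) \<partial>D)"
      by (simp only: m_def)
    also have "\<dots> = (-2 * c) * (\<integral>x. (x \<bullet> u) * (x \<bullet> v1) \<partial>D) + (2 * c * c) * (\<integral>x. (x \<bullet> u) * (x \<bullet> u) \<partial>D)"
      using inner_cov_matrix(1)[OF D sets bnd] by simp
    finally show ?thesis by (simp add: algebra_simps)
  qed
  also have "\<dots> = - (2 * c^2 * (lambda1 \<Sigma> - u \<bullet> (\<Sigma> *v u)))"
    using inner_cov_matrix(2)[OF D sets bnd] v1(2)
    by (simp add: \<Sigma>_def c_def power2_eq_square algebra_simps)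
  also have "\<dots> \<le> - (\<rho> * S)"
  proof -
    have g: "\<rho> * S \<le> lambda1 \<Sigma> - u \<bullet> (\<Sigma> *v u)"
      using quadratic_form_gap[OF _ dimp gap v1 u] cov_matrix_symmetric[of D "\<lambda>x. x"]
      by (simp add: rho Seq c_def \<Sigma>_def)
    have "0 \<le> \<rho> * S" using gap rho S0 by simp
    \<comment> \<open>The localisation \<open>half\<close> enters here: it prevents the factor
      \<open>2 * c^2\<close> from weakening the drift.\<close>
    moreover have "1 \<le> 2 * c^2" using half by (simp add: S_def[symmetric] Seq)
    ultimately have "1 * (\<rho> * S) \<le> (2 * c^2) * (lambda1 \<Sigma> - u \<bullet> (\<Sigma> *v u))"
      using g by (intro mult_mono) auto
    then show ?thesis by simp
  qed
  finally have m: "m \<le> - (\<rho> * S)" .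
  have "(\<integral>\<^sup>+x. ennreal (exp (\<theta> * sin2 (oja_step h x v) v1)) \<partial>D)
    \<le> (\<integral>\<^sup>+x. ennreal (exp (\<theta> * (S + h * m + h^2 * B^4 / 4))) * ennreal (exp ((\<theta> * h) * (f x - m))) \<partial>D)"
  proof (rule nn_integral_mono_AE)
    show "AE x in D. ennreal (exp (\<theta> * sin2 (oja_step h x v) v1))
      \<le> ennreal (exp (\<theta> * (S + h * m + h^2 * B^4 / 4))) * ennreal (exp ((\<theta> * h) * (f x - m)))"
      using bnd
    proof eventually_elim
      case (elim x)
      have "sin2 (oja_step h x v) v1 \<le> S + h * f x + h^2 * norm x^4 / 4"
        using sin2_oja_step_unit_le[OF u v1(1), of h x] by (simp add: step Seq f_def c_def)
      also have "\<dots> \<le> S + h * f x + h^2 * B^4 / 4"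
        using elim by (intro add_left_mono divide_right_mono mult_left_mono power_mono) auto
      finally have "\<theta> * sin2 (oja_step h x v) v1 \<le> \<theta> * (S + h * f x + h^2 * B^4 / 4)"
        using pos by (intro mult_left_mono) auto
      then show ?case
        by (simp add: ennreal_mult[symmetric] exp_add[symmetric] algebra_simps)
    qed
  qed
  also have "\<dots> = ennreal (exp (\<theta> * (S + h * m + h^2 * B^4 / 4)))
      * (\<integral>\<^sup>+x. ennreal (exp ((\<theta> * h) * (f x - m))) \<partial>D)"
    by (rule nn_integral_cmult) (simp add: f_def)
  also have "\<dots> \<le> ennreal (exp (\<theta> * (S + h * m + h^2 * B^4 / 4)))
      * ennreal (exp ((\<theta> * h)^2 * (sqrt S * B^2 - - (sqrt S * B^2))^2 / 8))"
    using Hoeffdings_lemma_nn_integral[of "\<theta> * h"] pos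
    by (intro mult_left_mono) (auto simp: m_def)
  also have "\<dots> = ennreal (exp (\<theta> * (S + h * m + h^2 * B^4 / 4) + \<theta>^2 * h^2 * S * B^4 / 2))"
    using S0 by (simp add: ennreal_mult[symmetric] exp_add[symmetric] power_mult_distrib)
  also have "\<dots> \<le> ennreal (exp (\<theta> * S * (1 - h * \<rho> + \<theta> * h^2 * B^4 / 2) + \<theta> * h^2 * B^4 / 4))"
  proof -
    have "\<theta> * h * m \<le> \<theta> * h * (- (\<rho> * S))" using pos m by (intro mult_left_mono) auto
    then show ?thesis by (simp add: algebra_simps power2_eq_square)
  qed
  finally show ?thesis by (simp add: S_def)
qed

subsection \<open>Ville's inequality and independence\<close>

text \<open>The sets A(t) are predictable: membership at time t + 1 is decided at time t. This lets the
  supermartingale property fail as soon as the process leaves them.\<close>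

lemma ville_finite_horizon:
  fixes Z :: "nat \<Rightarrow> 'a \<Rightarrow> ennreal"
  assumes Z[measurable]: "\<And>t. Z t \<in> borel_measurable M"
    and A[measurable]: "\<And>t. A t \<in> sets M" and A_dec: "\<And>t. A (Suc t) \<subseteq> A t"
    and super: "\<And>t. t < N \<Longrightarrow> (\<integral>\<^sup>+\<omega>\<in>{\<omega>\<in>A (Suc t). \<forall>r\<le>t. Z r \<omega> < a}. Z (Suc t) \<omega> \<partial>M)
        \<le> (\<integral>\<^sup>+\<omega>\<in>{\<omega>\<in>A (Suc t). \<forall>r\<le>t. Z r \<omega> < a}. Z t \<omega> \<partial>M)"
  shows "a * emeasure M {\<omega>\<in>space M. \<exists>s\<le>N. \<omega> \<in> A s \<and> a \<le> Z s \<omega>} \<le> (\<integral>\<^sup>+\<omega>\<in>A 0. Z 0 \<omega> \<partial>M)"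
proof -
  \<comment> \<open>\<open>U t\<close> collects the crossings strictly before time \<open>t\<close>;
    \<open>C t\<close> collects the paths still inside \<open>A t\<close> that have not crossed
    before \<open>t\<close>.\<close>
  define U where "U t = {\<omega>\<in>space M. \<exists>s<t. \<omega> \<in> A s \<and> a \<le> Z s \<omega>}" for t
  define C where "C t = {\<omega>\<in>space M. \<omega> \<in> A t \<and> (\<forall>r<t. Z r \<omega> < a)}" for t
  have A_mono: "A t \<subseteq> A s" if "s \<le> t" for s t
    using lift_Suc_antimono_le[of A, OF A_dec that] .
  have [measurable]: "U t \<in> sets M" "C t \<in> sets M" for t unfolding U_def C_def by measurable
  have C_Suc: "C (Suc t) = {\<omega>\<in>A (Suc t). \<forall>r\<le>t. Z r \<omega> < a}" for t
    using sets.sets_into_space[OF A] by (auto simp: C_def less_Suc_eq_le)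
  \<comment> \<open>Paths of \<open>C t\<close> that cross at time \<open>t\<close> form
    \<open>E\<close>, where \<open>Z t\<close> is at least \<open>a\<close> and so pays for the
    growth of \<open>U\<close>. The set \<open>C (Suc t)\<close> is disjoint from \<open>E\<close>
    and also lies in \<open>C t\<close>.\<close>
  have key: "a * emeasure M (U (Suc t)) + (\<integral>\<^sup>+\<omega>\<in>C (Suc t). Z t \<omega> \<partial>M)
      \<le> a * emeasure M (U t) + (\<integral>\<^sup>+\<omega>\<in>C t. Z t \<omega> \<partial>M)" for t
  proof -
    define E where "E = {\<omega>\<in>space M. \<omega> \<in> C t \<and> a \<le> Z t \<omega>}"
    have [measurable]: "E \<in> sets M" unfolding E_def by measurable
    have "U (Suc t) \<subseteq> U t \<union> E"
    proof
      fix \<omega> assume "\<omega> \<in> U (Suc t)"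
      then obtain s where s: "s \<le> t" "\<omega> \<in> space M" "\<omega> \<in> A s" "a \<le> Z s \<omega>"
        by (auto simp: U_def less_Suc_eq_le)
      show "\<omega> \<in> U t \<union> E"
      proof (cases "\<exists>r<t. a \<le> Z r \<omega> \<and> \<omega> \<in> A r")
        case True then show ?thesis using s by (auto simp: U_def)
      next
        case False
        then have "s = t" using s by (metis le_neq_implies_less)
        have "Z r \<omega> < a" if "r < t" for r
          using False A_mono[of r t] s(3) that \<open>s = t\<close> by (meson less_imp_le not_le subsetD)
        with s \<open>s = t\<close> show ?thesis by (simp add: E_def C_def)
      qed
    qed
    then have "emeasure M (U (Suc t)) \<le> emeasure M (U t \<union> E)"
      by (rule emeasure_mono) measurable
    also have "\<dots> \<le> emeasure M (U t) + emeasure M E"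
      by (rule emeasure_subadditive) auto
    finally have "a * emeasure M (U (Suc t)) \<le> a * emeasure M (U t) + a * emeasure M E"
      by (metis distrib_left mult_left_mono zero_le)
    then have "a * emeasure M (U (Suc t)) + (\<integral>\<^sup>+\<omega>\<in>C (Suc t). Z t \<omega> \<partial>M)
       \<le> a * emeasure M (U t) + ((\<integral>\<^sup>+\<omega>. a * indicator E \<omega> \<partial>M) + (\<integral>\<^sup>+\<omega>\<in>C (Suc t). Z t \<omega> \<partial>M))"
      by (simp add: nn_integral_cmult add.assoc[symmetric] add_right_mono)
    also have "(\<integral>\<^sup>+\<omega>. a * indicator E \<omega> \<partial>M) + (\<integral>\<^sup>+\<omega>\<in>C (Suc t). Z t \<omega> \<partial>M)
       = (\<integral>\<^sup>+\<omega>. a * indicator E \<omega> + Z t \<omega> * indicator (C (Suc t)) \<omega> \<partial>M)"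
      by (rule nn_integral_add[symmetric]) measurable
    also have "\<dots> \<le> (\<integral>\<^sup>+\<omega>\<in>C t. Z t \<omega> \<partial>M)"
      using A_dec[of t]
      by (intro nn_integral_mono) (auto simp: indicator_def E_def C_def less_Suc_eq)
    finally show ?thesis by (simp add: add_left_mono)
  qed
  have claim: "a * emeasure M (U t) + (\<integral>\<^sup>+\<omega>\<in>C t. Z t \<omega> \<partial>M) \<le> (\<integral>\<^sup>+\<omega>\<in>A 0. Z 0 \<omega> \<partial>M)" if "t \<le> N" for t
    using that
  proof (induction t)
    case 0
    have "C 0 = A 0" using sets.sets_into_space[OF A] by (auto simp: C_def)
    then show ?case by (simp add: U_def)
  next
    case (Suc t)
    have "a * emeasure M (U (Suc t)) + (\<integral>\<^sup>+\<omega>\<in>C (Suc t). Z (Suc t) \<omega> \<partial>M)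
        \<le> a * emeasure M (U (Suc t)) + (\<integral>\<^sup>+\<omega>\<in>C (Suc t). Z t \<omega> \<partial>M)"
      using super[of t] Suc.prems by (intro add_left_mono) (simp add: C_Suc)
    also note key[of t]
    also have "a * emeasure M (U t) + (\<integral>\<^sup>+\<omega>\<in>C t. Z t \<omega> \<partial>M) \<le> (\<integral>\<^sup>+\<omega>\<in>A 0. Z 0 \<omega> \<partial>M)"
      using Suc by simp
    finally show ?case .
  qed
  have "a * emeasure M (U (Suc N)) \<le> a * emeasure M (U (Suc N)) + (\<integral>\<^sup>+\<omega>\<in>C (Suc N). Z N \<omega> \<partial>M)"
    by simp
  also note key[of N]
  also note claim[of N]
  finally show ?thesis by (simp add: U_def less_Suc_eq_le)
qed

text \<open>A conditional expectation argument done by Tonelli: the joint law of past and next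
  sample is a product, so the next sample is integrated first with the past \<open>w\<close>
  fixed.\<close>

lemma (in prob_space) nn_integral_indep_next_le:
  fixes Y :: "nat \<Rightarrow> 'a \<Rightarrow> 'b::second_countable_topology"
  assumes ind: "indep_vars (\<lambda>_. borel) Y UNIV"
    and f[measurable]: "f \<in> borel_measurable (PiM {..t} (\<lambda>_. borel) \<Otimes>\<^sub>M borel)"
    and g[measurable]: "g \<in> borel_measurable (PiM {..t} (\<lambda>_. borel))"
    and le: "\<And>w. w \<in> space (PiM {..t} (\<lambda>_. borel :: 'b measure))
        \<Longrightarrow> (\<integral>\<^sup>+x. f (w, x) \<partial>distr M borel (Y (Suc t))) \<le> g w"
  shows "(\<integral>\<^sup>+\<omega>. f (restrict (\<lambda>i. Y i \<omega>) {..t}, Y (Suc t) \<omega>) \<partial>M)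
      \<le> (\<integral>\<^sup>+\<omega>. g (restrict (\<lambda>i. Y i \<omega>) {..t}) \<partial>M)"
proof -
  define W where "W = (\<lambda>\<omega>. restrict (\<lambda>i. Y i \<omega>) {..t})"
  let ?P = "PiM {..t} (\<lambda>_. borel :: 'b measure)"
  \<comment> \<open>The next sample is packed as a family over a one-point index set, the form in
    which independence of disjoint blocks is available.\<close>
  define V where "V = (\<lambda>\<omega>. restrict (\<lambda>i. Y i \<omega>) {Suc t})"
  let ?Q = "PiM {Suc t} (\<lambda>_. borel :: 'b measure)"
  have "indep_var ?P W ?Q V"
    unfolding W_def V_def by (rule indep_var_restrict[OF ind]) auto
  then have [measurable]: "W \<in> measurable M ?P" "V \<in> measurable M ?Q"
    and eq: "distr M ?P W \<Otimes>\<^sub>M distr M ?Q V = distr M (?P \<Otimes>\<^sub>M ?Q) (\<lambda>\<omega>. (W \<omega>, V \<omega>))"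
    by (auto simp: indep_var_distribution_eq)
  have [measurable]: "Y (Suc t) \<in> borel_measurable M"
    using ind by (simp add: indep_vars_def)
  have VY: "V \<omega> (Suc t) = Y (Suc t) \<omega>" for \<omega> by (simp add: V_def)
  have [measurable]: "(\<lambda>v. v (Suc t)) \<in> measurable ?Q borel"
    by (rule measurable_component_singleton) simp
  interpret Q: prob_space "distr M ?Q V" by (rule prob_space_distr) simp
  have "(\<integral>\<^sup>+\<omega>. f (W \<omega>, Y (Suc t) \<omega>) \<partial>M)
      = (\<integral>\<^sup>+z. f (fst z, snd z (Suc t)) \<partial>distr M (?P \<Otimes>\<^sub>M ?Q) (\<lambda>\<omega>. (W \<omega>, V \<omega>)))"
    by (subst nn_integral_distr) (simp_all add: VY)
  also have "\<dots> = (\<integral>\<^sup>+w. \<integral>\<^sup>+v. f (w, v (Suc t)) \<partial>distr M ?Q V \<partial>distr M ?P W)"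
    unfolding eq[symmetric]
    by (subst Q.nn_integral_fst[symmetric]) (simp_all cong: measurable_cong_sets)
  also have "\<dots> = (\<integral>\<^sup>+w. \<integral>\<^sup>+x. f (w, x) \<partial>distr M borel (Y (Suc t)) \<partial>distr M ?P W)"
    by (intro nn_integral_cong) (simp add: nn_integral_distr VY)
  also have "\<dots> \<le> (\<integral>\<^sup>+w. g w \<partial>distr M ?P W)"
    by (rule nn_integral_mono) (simp add: le)
  also have "\<dots> = (\<integral>\<^sup>+\<omega>. g (W \<omega>) \<partial>M)" by (rule nn_integral_distr) auto
  finally show ?thesis by (simp add: W_def)
qed

subsection \<open>The localised supermartingale\<close>

lemma borel_measurable_oja_step[measurable]:
  assumes [measurable]: "f \<in> borel_measurable M" "g \<in> borel_measurable M"
  shows "(\<lambda>\<omega>. oja_step h (f \<omega>) (g \<omega>)) \<in> borel_measurable M"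
  unfolding oja_step_def by measurable

lemma borel_measurable_sin2[measurable]:
  assumes [measurable]: "f \<in> borel_measurable M" "g \<in> borel_measurable M"
  shows "(\<lambda>\<omega>. sin2 (f \<omega>) (g \<omega>)) \<in> borel_measurable M"
  unfolding sin2_def by measurable

lemma borel_measurable_kooja:
  assumes "\<And>s. s \<le> t \<Longrightarrow> (\<lambda>\<omega>. Y \<omega> s) \<in> borel_measurable M"
  shows "(\<lambda>\<omega>. kooja eta (Y \<omega>) (Y \<omega> 0) t) \<in> borel_measurable M"
  using assms
proof (induction t)
  case (Suc t)
  have [measurable]: "(\<lambda>\<omega>. kooja eta (Y \<omega>) (Y \<omega> 0) t) \<in> borel_measurable M"
    "(\<lambda>\<omega>. Y \<omega> (Suc t)) \<in> borel_measurable M" using Suc by auto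
  show ?case unfolding kooja_Suc by measurable
qed simp

text \<open>The initial vector is the coordinate Y 0 of the data stream.\<close>

locale oja_stream = prob_space M for M :: "'a measure" +
  fixes Y :: "nat \<Rightarrow> 'a \<Rightarrow> real^'n" and D :: "(real^'n) measure"
    and B \<rho> Lc :: real and v1 :: "real^'n" and \<eta> :: "nat \<Rightarrow> real"
  assumes indep: "indep_vars (\<lambda>_. borel) Y UNIV"
    and ident: "\<And>t. t \<ge> 1 \<Longrightarrow> distr M borel (Y t) = D"
    and bnd: "AE x in D. norm x \<le> B"
    and B_pos: "B > 0"
    and dimp: "CARD('n) \<ge> 2"
    and gap: "lambda2 (cov_matrix D (\<lambda>x. x)) < lambda1 (cov_matrix D (\<lambda>x. x))"
    and v1: "norm v1 = 1" "cov_matrix D (\<lambda>x. x) *v v1 = lambda1 (cov_matrix D (\<lambda>x. x)) *\<^sub>R v1"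
    and rho: "\<rho> = lambda1 (cov_matrix D (\<lambda>x. x)) - lambda2 (cov_matrix D (\<lambda>x. x))"
    and Lc: "Lc \<ge> 1"
    and eta: "\<And>t. \<eta> t = 2 / (\<rho> * (real t + Lc))"
begin

text \<open>The argument is a whole path with the initial vector at coordinate 0, so the same
  function serves on the sample space and on finite products.\<close>

definition err :: "nat \<Rightarrow> (nat \<Rightarrow> real^'n) \<Rightarrow> real" where
  "err t w = sin2 (kooja \<eta> w (w 0) t) v1"

definition T :: "nat \<Rightarrow> real" where "T t = real t + Lc"

definition b :: real where "b = B^4 / \<rho>^2"

definition \<theta> :: "real \<Rightarrow> nat \<Rightarrow> real" where
  "\<theta> H t = T t * sqrt (T t / H) / (4 * b)"

definition pot :: "real \<Rightarrow> nat \<Rightarrow> (nat \<Rightarrow> real^'n) \<Rightarrow> real" where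
  "pot H t w = exp (\<theta> H t * err t w - sqrt (T t / H) / 2)"

lemma rho_pos: "\<rho> > 0" using gap rho by simp

lemma b_pos: "b > 0" using B_pos rho_pos by (simp add: b_def)

lemma T_ge: "T t \<ge> Lc" "T t \<ge> 1" "T t > 0" using Lc by (simp_all add: T_def)

lemma theta_pos: "H > 0 \<Longrightarrow> \<theta> H t > 0"
  using T_ge[of t] b_pos by (simp add: \<theta>_def)

lemma measurable_Y[measurable]: "Y t \<in> borel_measurable M"
  using indep by (simp add: indep_vars_def)

lemma prob_space_D: "prob_space D"
  using ident[of 1] prob_space_distr[OF measurable_Y[of 1]] by simp

lemma sets_D: "sets D = sets borel"
  using ident[of 1] by (metis le_refl sets_distr)

lemma err_restrict: "s \<le> t \<Longrightarrow> err s (restrict w {..t}) = err s w"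
  unfolding err_def by (simp add: kooja_cong[of s "restrict w {..t}" w])

lemma measurable_err_Pi[measurable]:
  "s \<le> t \<Longrightarrow> err s \<in> borel_measurable (PiM {..t} (\<lambda>_. borel))"
  unfolding err_def
  by (intro borel_measurable_sin2 borel_measurable_kooja measurable_component_singleton) auto

lemma measurable_err[measurable]: "(\<lambda>\<omega>. err t (\<lambda>i. Y i \<omega>)) \<in> borel_measurable M"
  unfolding err_def by (intro borel_measurable_sin2 borel_measurable_kooja) auto

lemma measurable_pot[measurable]: "(\<lambda>\<omega>. pot H t (\<lambda>i. Y i \<omega>)) \<in> borel_measurable M"
  unfolding pot_def by measurable

text \<open>These are the two requirements for the supermartingale: the first absorbs the
  coefficient of the error, the second lets the additive noise telescope into differences of square
  roots.\<close>

lemma theta_step: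
  assumes "T (Suc t) \<le> H"
  shows "\<theta> H (Suc t) * (1 - 2 / T (Suc t) + 2 * \<theta> H (Suc t) * b / (T (Suc t))^2) \<le> \<theta> H t"
    and "\<theta> H (Suc t) * b / (T (Suc t))^2 \<le> sqrt (T (Suc t) / H) / 2 - sqrt (T t / H) / 2"
proof -
  define r where "r = T (Suc t)"
  have Tt: "T t = r - 1" by (simp add: T_def r_def)
  have r1: "r > 1" "r - 1 > 0" using T_ge[of t] Tt by auto
  have H: "H > 0" using assms r1 by (simp add: r_def)
  have rH: "sqrt (r / H) \<le> 1" using assms H by (simp add: r_def)
  \<comment> \<open>As long as \<open>r \<le> H\<close>, Hoeffding's term costs at most
    \<open>1 / (2 * r)\<close> of the contraction \<open>2 / r\<close>; what is left is
    \<open>3 / (2 * r)\<close>, matching the exponent 3/2 of the weights.\<close>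
  have 1: "1 - 2 / r + 2 * \<theta> H (Suc t) * b / r^2 \<le> 1 - 3 / (2 * r)"
  proof -
    have "2 * \<theta> H (Suc t) * b / r^2 = sqrt (r / H) / (2 * r)"
      using b_pos r1 by (simp add: \<theta>_def r_def[symmetric] field_simps power2_eq_square)
    also have "\<dots> \<le> 1 / (2 * r)" using rH r1 by (intro divide_right_mono) auto
    finally show ?thesis using r1 by (simp add: field_simps)
  qed
  \<comment> \<open>Twice the tangent bound at \<open>r\<close> for the convex power 3/2, evaluated
    at \<open>r - 1\<close>. Squaring requires a nonnegative left side, hence the case
    split.\<close>
  have 2: "sqrt r * (2 * r - 3) \<le> 2 * (r - 1) * sqrt (r - 1)"
  proof (cases "2 * r - 3 \<ge> 0")
    case True
    have "r * (2 * r - 3)^2 \<le> (2 * (r - 1))^2 * (r - 1)"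
      using r1 True by (simp add: power2_eq_square algebra_simps)
    then have "sqrt (r * (2 * r - 3)^2) \<le> sqrt ((2 * (r - 1))^2 * (r - 1))" by (rule real_sqrt_le_mono)
    then show ?thesis using r1 True by (simp add: real_sqrt_mult)
  next
    case False
    then have "sqrt r * (2 * r - 3) \<le> 0" using r1 by (intro mult_nonneg_nonpos) auto
    also have "0 \<le> 2 * (r - 1) * sqrt (r - 1)" using r1 by simp
    finally show ?thesis .
  qed
  have "\<theta> H (Suc t) * (1 - 2 / r + 2 * \<theta> H (Suc t) * b / r^2) \<le> \<theta> H (Suc t) * (1 - 3 / (2 * r))"
    using theta_pos[OF H] by (intro mult_left_mono 1) (simp add: less_imp_le)
  also have "\<dots> = sqrt r * (2 * r - 3) / (8 * b * sqrt H)"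
    using r1 b_pos H by (simp add: \<theta>_def r_def[symmetric] real_sqrt_divide field_simps)
  also have "\<dots> \<le> 2 * (r - 1) * sqrt (r - 1) / (8 * b * sqrt H)"
    using b_pos H by (intro divide_right_mono 2) auto
  also have "\<dots> = \<theta> H t"
    using b_pos H by (simp add: \<theta>_def Tt real_sqrt_divide field_simps)
  finally show "\<theta> H (Suc t) * (1 - 2 / T (Suc t) + 2 * \<theta> H (Suc t) * b / (T (Suc t))^2) \<le> \<theta> H t"
    by (simp add: r_def)
  have "\<theta> H (Suc t) * b / r^2 = 1 / (4 * sqrt r * sqrt H)"
  proof -
    have "\<theta> H (Suc t) * b / r^2 = sqrt r / (4 * r * sqrt H)"
      using b_pos r1 by (simp add: \<theta>_def r_def[symmetric] real_sqrt_divide power2_eq_square)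
    also have "\<dots> = 1 / (4 * sqrt r * sqrt H)"
      using r1 H by (simp add: field_simps)
    finally show ?thesis .
  qed
  also have "\<dots> \<le> (sqrt r - sqrt (r - 1)) / (2 * sqrt H)"
  proof -
    have "1 = (sqrt r - sqrt (r - 1)) * (sqrt r + sqrt (r - 1))"
      using r1 by (simp add: algebra_simps)
    also have "\<dots> \<le> (sqrt r - sqrt (r - 1)) * (2 * sqrt r)"
      using r1 by (intro mult_left_mono) auto
    finally have "1 \<le> (sqrt r - sqrt (r - 1)) * (2 * sqrt r)" .
    then show ?thesis using r1 H by (simp add: field_simps)
  qed
  also have "\<dots> = sqrt (r / H) / 2 - sqrt (T t / H) / 2"
    unfolding Tt real_sqrt_divide by (simp add: diff_divide_distrib)
  finally show "\<theta> H (Suc t) * b / (T (Suc t))^2 \<le> sqrt (T (Suc t) / H) / 2 - sqrt (T t / H) / 2"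
    by (simp add: r_def)
qed

text \<open>The chosen step size gives \<open>h * \<rho> = 2 / r\<close> and
  \<open>h^2 * B^4 = 4 * b / r^2\<close>, after which \<open>theta_step\<close> closes the
  exponential moment bound.\<close>

lemma pot_step:
  assumes "T (Suc t) \<le> H" and half: "sin2 v v1 \<le> 1/2"
  shows "(\<integral>\<^sup>+x. ennreal (exp (\<theta> H (Suc t) * sin2 (oja_step (\<eta> (Suc t)) x v) v1 - sqrt (T (Suc t) / H) / 2)) \<partial>D)
     \<le> ennreal (exp (\<theta> H t * sin2 v v1 - sqrt (T t / H) / 2))"
proof -
  define h th r where "h = \<eta> (Suc t)" and "th = \<theta> H (Suc t)" and "r = T (Suc t)"
  define k where "k = sqrt (r / H) / 2"
  have r0: "r > 0" unfolding r_def by (rule T_ge)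
  then have H: "H > 0" using assms(1) by (simp add: r_def)
  have h: "h = 2 / (\<rho> * r)" by (simp add: h_def r_def eta T_def)
  have pos: "h > 0" "th > 0" using rho_pos r0 theta_pos[OF H] by (simp_all add: h th_def)
  note [measurable_cong] = sets_D
  have e1: "h * \<rho> = 2 / r" using rho_pos by (simp add: h)
  have e2: "h^2 * B^4 = 4 * b / r^2" by (simp add: h b_def power_divide power_mult_distrib)
  have "(\<integral>\<^sup>+x. ennreal (exp (th * sin2 (oja_step h x v) v1 - k)) \<partial>D)
      = (\<integral>\<^sup>+x. ennreal (exp (- k)) * ennreal (exp (th * sin2 (oja_step h x v) v1)) \<partial>D)"
    by (simp add: ennreal_mult[symmetric] exp_add[symmetric])
  also have "\<dots> = ennreal (exp (- k)) * (\<integral>\<^sup>+x. ennreal (exp (th * sin2 (oja_step h x v) v1)) \<partial>D)"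
    by (rule nn_integral_cmult) measurable
  also have "\<dots> \<le> ennreal (exp (- k)) * ennreal (exp (th * sin2 v v1 * (1 - h * \<rho> + th * h^2 * B^4 / 2) + th * h^2 * B^4 / 4))"
    by (intro mult_left_mono exp_moment_oja_step[OF prob_space_D sets_D bnd dimp gap v1 rho pos half]) simp
  also have "\<dots> = ennreal (exp (sin2 v v1 * (th * (1 - 2 / r + 2 * th * b / r^2)) + th * b / r^2 - k))"
  proof -
    have "th * h^2 * B^4 / 2 = 2 * th * b / r^2" "th * h^2 * B^4 / 4 = th * b / r^2"
      using e2 by (simp_all add: mult.assoc)
    then show ?thesis
      unfolding e1 by (simp add: ennreal_mult[symmetric] exp_add[symmetric] algebra_simps)
  qed
  also have "\<dots> \<le> ennreal (exp (\<theta> H t * sin2 v v1 - sqrt (T t / H) / 2))"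
  proof -
    have "sin2 v v1 * (th * (1 - 2 / r + 2 * th * b / r^2)) \<le> sin2 v v1 * \<theta> H t"
      using theta_step(1)[OF assms(1)] by (intro mult_left_mono sin2_nonneg) (simp add: th_def r_def)
    then show ?thesis
      using theta_step(2)[OF assms(1)] by (simp add: th_def r_def k_def mult.commute)
  qed
  finally show ?thesis by (simp add: h_def th_def r_def k_def)
qed

text \<open>Ville's inequality for \<open>pot\<close>, localised to paths that start below 1/4 and
  have stayed below 1/2. The initial bound 1/4 also controls the starting value of the
  potential.\<close>

lemma pot_crossing:
  assumes "T N \<le> H" "a > 0"
  shows "emeasure M {\<omega>\<in>space M. \<exists>s\<le>N. (err 0 (\<lambda>i. Y i \<omega>) \<le> 1/4 \<and> (\<forall>r<s. err r (\<lambda>i. Y i \<omega>) \<le> 1/2))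
      \<and> a \<le> pot H s (\<lambda>i. Y i \<omega>)} \<le> ennreal (exp (\<theta> H 0 / 4) / a)"
proof -
  define Z where "Z t \<omega> = ennreal (pot H t (\<lambda>i. Y i \<omega>))" for t \<omega>
  define A where "A t = {\<omega>\<in>space M. err 0 (\<lambda>i. Y i \<omega>) \<le> 1/4 \<and> (\<forall>r<t. err r (\<lambda>i. Y i \<omega>) \<le> 1/2)}" for t
  have H: "H > 0" using T_ge(3)[of N] assms by simp
  have [measurable]: "Z t \<in> borel_measurable M" "A t \<in> sets M" for t
    unfolding Z_def A_def by measurable
  have super: "(\<integral>\<^sup>+\<omega>\<in>{\<omega>\<in>A (Suc t). \<forall>r\<le>t. Z r \<omega> < ennreal a}. Z (Suc t) \<omega> \<partial>M)
        \<le> (\<integral>\<^sup>+\<omega>\<in>{\<omega>\<in>A (Suc t). \<forall>r\<le>t. Z r \<omega> < ennreal a}. Z t \<omega> \<partial>M)" if "t < N" for t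
  proof -
    have TH: "T (Suc t) \<le> H" using that assms(1) by (simp add: T_def)
    let ?P = "PiM {..t} (\<lambda>_. borel :: (real^'n) measure)"
    \<comment> \<open>The localisation and the absence of earlier crossings, expressed through the
      path up to time \<open>t\<close> alone, so that the next sample is independent of
      them.\<close>
    define Q where "Q w \<longleftrightarrow> err 0 w \<le> 1/4 \<and> (\<forall>r\<in>{..t}. err r w \<le> 1/2) \<and> (\<forall>r\<in>{..t}. pot H r w < a)" for w
    have [measurable]: "Measurable.pred ?P Q"
      unfolding Q_def pot_def
      by (intro pred_intros_logic pred_intros_finite borel_measurable_le borel_measurable_less
          borel_measurable_const borel_measurable_exp borel_measurable_diff borel_measurable_times
          measurable_err_Pi) auto
    define C where "C = {w\<in>space ?P. Q w}"
    have [measurable]: "C \<in> sets ?P" unfolding C_def by measurable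
    have [measurable]: "(\<lambda>w. kooja \<eta> w (w 0) t) \<in> borel_measurable ?P"
      by (intro borel_measurable_kooja measurable_component_singleton) auto
    define f where "f z = ennreal (exp (\<theta> H (Suc t) * sin2 (oja_step (\<eta> (Suc t)) (snd z) (kooja \<eta> (fst z) (fst z 0) t)) v1
        - sqrt (T (Suc t) / H) / 2)) * indicator C (fst z)" for z :: "(nat \<Rightarrow> real^'n) \<times> (real^'n)"
    define g where "g w = ennreal (pot H t w) * indicator C w" for w
    have [measurable]: "f \<in> borel_measurable (?P \<Otimes>\<^sub>M borel)" "g \<in> borel_measurable ?P"
      unfolding f_def g_def pot_def by measurable
    have W: "restrict (\<lambda>i. Y i \<omega>) {..t} \<in> C \<longleftrightarrow> \<omega> \<in> {\<omega>\<in>A (Suc t). \<forall>r\<le>t. Z r \<omega> < ennreal a}"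
      if "\<omega> \<in> space M" for \<omega>
      using that
      by (auto simp: C_def Q_def A_def Z_def pot_def err_restrict less_Suc_eq_le space_PiM ennreal_less_iff)
    have "(\<integral>\<^sup>+\<omega>\<in>{\<omega>\<in>A (Suc t). \<forall>r\<le>t. Z r \<omega> < ennreal a}. Z (Suc t) \<omega> \<partial>M)
        = (\<integral>\<^sup>+\<omega>. f (restrict (\<lambda>i. Y i \<omega>) {..t}, Y (Suc t) \<omega>) \<partial>M)"
    proof (intro nn_integral_cong)
      fix \<omega> assume "\<omega> \<in> space M"
      then show "Z (Suc t) \<omega> * indicator {\<omega>\<in>A (Suc t). \<forall>r\<le>t. Z r \<omega> < ennreal a} \<omega>
          = f (restrict (\<lambda>i. Y i \<omega>) {..t}, Y (Suc t) \<omega>)"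
        using W[of \<omega>] kooja_cong[of t "restrict (\<lambda>i. Y i \<omega>) {..t}" "\<lambda>i. Y i \<omega>" \<eta>]
        by (simp add: f_def Z_def pot_def err_def kooja_Suc indicator_def del: kooja.simps(2))
    qed
    also have "\<dots> \<le> (\<integral>\<^sup>+\<omega>. g (restrict (\<lambda>i. Y i \<omega>) {..t}) \<partial>M)"
    proof (rule nn_integral_indep_next_le[OF indep])
      fix w assume "w \<in> space ?P"
      show "(\<integral>\<^sup>+x. f (w, x) \<partial>distr M borel (Y (Suc t))) \<le> g w"
      proof (cases "w \<in> C")
        case True
        then have "sin2 (kooja \<eta> w (w 0) t) v1 \<le> 1/2" by (simp add: C_def Q_def err_def)
        from pot_step[OF TH this] True ident[of "Suc t"] show ?thesis
          by (simp add: f_def g_def pot_def err_def)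
      qed (simp add: f_def)
    qed measurable
    also have "\<dots> = (\<integral>\<^sup>+\<omega>\<in>{\<omega>\<in>A (Suc t). \<forall>r\<le>t. Z r \<omega> < ennreal a}. Z t \<omega> \<partial>M)"
    proof (intro nn_integral_cong)
      fix \<omega> assume "\<omega> \<in> space M"
      then show "g (restrict (\<lambda>i. Y i \<omega>) {..t}) = Z t \<omega> * indicator {\<omega>\<in>A (Suc t). \<forall>r\<le>t. Z r \<omega> < ennreal a} \<omega>"
        using W[of \<omega>] by (simp add: g_def Z_def pot_def err_restrict indicator_def)
    qed
    finally show ?thesis .
  qed
  have "ennreal a * emeasure M {\<omega>\<in>space M. \<exists>s\<le>N. \<omega> \<in> A s \<and> ennreal a \<le> Z s \<omega>} \<le> (\<integral>\<^sup>+\<omega>\<in>A 0. Z 0 \<omega> \<partial>M)"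
    by (rule ville_finite_horizon[OF _ _ _ super]) (auto simp: A_def)
  also have "\<dots> \<le> (\<integral>\<^sup>+\<omega>. ennreal (exp (\<theta> H 0 / 4)) \<partial>M)"
  proof (rule nn_integral_mono)
    fix \<omega>
    have "pot H 0 (\<lambda>i. Y i \<omega>) \<le> exp (\<theta> H 0 / 4)" if "\<omega> \<in> A 0"
    proof -
      have "\<theta> H 0 * err 0 (\<lambda>i. Y i \<omega>) \<le> \<theta> H 0 * (1/4)"
        using that theta_pos[OF H, of 0] by (intro mult_left_mono) (auto simp: A_def)
      moreover have "sqrt (T 0 / H) \<ge> 0" using T_ge[of 0] H by simp
      ultimately show ?thesis unfolding pot_def exp_le_cancel_iff by linarith
    qed
    then show "Z 0 \<omega> * indicator (A 0) \<omega> \<le> ennreal (exp (\<theta> H 0 / 4))"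
      by (auto simp: Z_def indicator_def ennreal_leI)
  qed
  also have "\<dots> = ennreal (exp (\<theta> H 0 / 4))" by (simp add: emeasure_space_1)
  finally have "ennreal a * emeasure M {\<omega>\<in>space M. \<exists>s\<le>N. \<omega> \<in> A s \<and> ennreal a \<le> Z s \<omega>} / ennreal a
      \<le> ennreal (exp (\<theta> H 0 / 4)) / ennreal a"
    by (rule divide_right_mono_ennreal)
  moreover have "{\<omega>\<in>space M. \<exists>s\<le>N. \<omega> \<in> A s \<and> ennreal a \<le> Z s \<omega>}
     = {\<omega>\<in>space M. \<exists>s\<le>N. (err 0 (\<lambda>i. Y i \<omega>) \<le> 1/4 \<and> (\<forall>r<s. err r (\<lambda>i. Y i \<omega>) \<le> 1/2))
      \<and> a \<le> pot H s (\<lambda>i. Y i \<omega>)}"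
    using assms(2) by (auto simp: A_def Z_def pot_def)
  moreover have "ennreal a * x / ennreal a = x" for x
    using assms(2) by (simp add: ennreal_mult_divide_eq mult.commute)
  ultimately show ?thesis
    using assms(2) by (simp add: divide_ennreal)
qed

end

subsection \<open>The uniform rate\<close>

lemma ex_power_bracket:
  fixes c x :: real
  assumes "c > 1" "x \<ge> 1"
  obtains k :: nat where "c^k \<le> x" "x < c^(k+1)"
proof -
  define n where "n = (LEAST n. x < c^n)"
  have n: "x < c^n" unfolding n_def using real_arch_pow[OF assms(1), of x] by (rule LeastI_ex)
  with assms(2) obtain k where k: "n = Suc k" by (cases n) auto
  then have "\<not> x < c^k" unfolding n_def by (intro not_less_Least) simp
  with n k that[of k] show ?thesis by simp
qed

context oja_stream
begin

text \<open>A deterministic strong induction. The bound 1/2 at earlier times activates the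
  no-crossing hypothesis at \<open>t\<close>; the resulting rate, with \<open>Lc\<close> large
  enough, returns the bound 1/2 at \<open>t\<close>.\<close>

lemma err_bound_if_no_crossing:
  assumes l: "l \<ge> 1" and Lc_ge: "Lc \<ge> 128 * b * l^2"
    and init: "err 0 w \<le> 1/4"
    and no: "\<And>k s. T s \<le> 4^(k+1) * Lc \<Longrightarrow> (\<And>r. r < s \<Longrightarrow> err r w \<le> 1/2)
        \<Longrightarrow> pot (4^(k+1) * Lc) s w < exp (\<theta> (4^(k+1) * Lc) 0 / 4 + l + 2 * ln (real k + 1))"
  shows "err t w \<le> 1/2 \<and> T t * err t w \<le> Lc / 4 + 8 * b * (1/2 + l + 2 * ln (2 * ln (real t + 9)))"
proof (induction t rule: less_induct)
  case (less t)
  have T1: "T t / Lc \<ge> 1" using T_ge[of t] Lc by simp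
  \<comment> \<open>The horizon \<open>4^(k+1) * Lc\<close> lies between \<open>T t\<close> and
    \<open>4 * T t\<close>, so \<open>q\<close> lies between 1/2 and 1.\<close>
  obtain k where k: "4^k \<le> T t / Lc" "T t / Lc < 4^(k+1)"
    by (rule ex_power_bracket[of 4 "T t / Lc"]) (use T1 in auto)
  define H where "H = 4^(k+1) * Lc"
  have Lc0: "Lc > 0" using Lc by simp
  have H0: "H > 0" using Lc0 by (simp add: H_def)
  have TH: "T t \<le> H" "H \<le> 4 * T t" "4^k * Lc \<le> T t" using k Lc0 by (simp_all add: H_def field_simps)
  define R where "R = 1/2 + l + 2 * ln (real k + 1)"
  define q where "q = sqrt (T t / H)"
  define q0 where "q0 = sqrt (Lc / H)"
  have q: "q \<le> 1" "1/2 \<le> q" "q0 \<le> q"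
  proof -
    show "q \<le> 1" using TH H0 by (simp add: q_def)
    have "sqrt (1/4) \<le> q" unfolding q_def using TH H0 by (intro real_sqrt_le_mono) (simp add: field_simps)
    then show "1/2 \<le> q" by (simp add: real_sqrt_divide)
    show "q0 \<le> q" unfolding q_def q0_def using T_ge[of t] H0
      by (intro real_sqrt_le_mono divide_right_mono) auto
  qed
  have R0: "R \<ge> 0" using l by (simp add: R_def)
  have "pot H t w < exp (\<theta> H 0 / 4 + l + 2 * ln (real k + 1))"
    unfolding H_def by (rule no) (use TH less in \<open>auto simp: H_def\<close>)
  then have "\<theta> H t * err t w - q / 2 < \<theta> H 0 / 4 + l + 2 * ln (real k + 1)"
    by (simp add: pot_def q_def)
  then have "\<theta> H t * err t w \<le> \<theta> H 0 / 4 + R"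
    using q by (simp add: R_def)
  then have "4 * b * (\<theta> H t * err t w) \<le> 4 * b * (\<theta> H 0 / 4 + R)"
    using b_pos by (intro mult_left_mono) auto
  moreover have "4 * b * (\<theta> H t * err t w) = q * (T t * err t w)"
    using b_pos by (simp add: \<theta>_def q_def)
  moreover have "4 * b * (\<theta> H 0 / 4 + R) = Lc * q0 / 4 + 4 * b * R"
    using b_pos by (simp add: \<theta>_def q0_def T_def distrib_left)
  ultimately have "q * (T t * err t w) \<le> Lc * q0 / 4 + 4 * b * R" by simp
  \<comment> \<open>Both summands receive the common factor \<open>q\<close>, using
    \<open>q0 \<le> q\<close> and \<open>1 \<le> 2 * q\<close>, so that it cancels.\<close>
  also have "\<dots> \<le> Lc * q / 4 + (4 * b * R) * (2 * q)"
  proof -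
    have "Lc * q0 \<le> Lc * q" using q Lc0 by (intro mult_left_mono) auto
    moreover have "(4 * b * R) * 1 \<le> (4 * b * R) * (2 * q)"
      using q R0 b_pos by (intro mult_left_mono) auto
    ultimately show ?thesis by linarith
  qed
  also have "\<dots> = q * (Lc / 4 + 8 * b * R)" by (simp add: algebra_simps)
  finally have bound: "T t * err t w \<le> Lc / 4 + 8 * b * R" using q by simp
  have ll: "l \<le> l^2" "1 \<le> l^2" using l by (simp_all add: power2_eq_square self_le_power)
     (use mult_mono[of 1 l 1 l] in auto)
  \<comment> \<open>The growth of \<open>R\<close> in \<open>k\<close> is beaten by
    \<open>4^k\<close>, and the constant 128 in \<open>Lc_ge\<close> leaves a quarter of
    \<open>T t\<close>. The term \<open>Lc / 4\<close> takes another quarter, which gives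
    1/2.\<close>
  have "8 * b * R \<le> T t / 4"
  proof -
    have pow: "1 + 3 * real k \<le> 4^k" using Bernoulli_inequality[of "3::real" k] by simp
    have "ln (real k + 1) \<le> real k" using ln_add_one_self_le_self[of "real k"] by (simp add: add.commute)
    then have "R \<le> 1/2 * l^2 + l^2 + (2 * real k) * 1" using ll by (simp add: R_def)
    also have "\<dots> \<le> 1/2 * l^2 + l^2 + (2 * real k) * l^2"
      using ll by (intro add_left_mono mult_left_mono) auto
    also have "\<dots> = (3/2 + 2 * real k) * l^2" by (simp add: algebra_simps)
    also have "\<dots> \<le> (4 * 4^k) * l^2" using pow by (intro mult_right_mono) auto
    finally have "b * R \<le> b * ((4 * 4^k) * l^2)" using b_pos by (intro mult_left_mono) auto
    also have "\<dots> = 4^k * (128 * b * l^2) / 32" by simp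
    also have "\<dots> \<le> 4^k * Lc / 32" using Lc_ge by (intro divide_right_mono mult_left_mono) auto
    also have "\<dots> \<le> T t / 32" using TH by simp
    finally show ?thesis by simp
  qed
  with bound have "T t * err t w \<le> T t * (1/2)" using T_ge(1)[of t] by linarith
  then have half: "err t w \<le> 1/2" using T_ge(3)[of t] by (simp only: mult_le_cancel_left_pos)
  \<comment> \<open>\<open>exp k \<le> 4^k \<le> 1 + t\<close> bounds \<open>k\<close> by a
    logarithm; the shift 9 also makes that logarithm at least 1, which absorbs the
    \<open>+ 1\<close>.\<close>
  have "ln (real k + 1) \<le> ln (2 * ln (real t + 9))"
  proof -
    have "exp (real k) = exp 1 ^ k" by (simp add: exp_of_nat_mult[symmetric])
    also have "\<dots> \<le> 4^k" using exp_le by (intro power_mono) auto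
    also have "\<dots> \<le> real t + 9"
    proof -
      have "T t / Lc = 1 + real t / Lc" using Lc0 by (simp add: T_def field_simps)
      also have "real t / Lc \<le> real t" using Lc0 mult_left_mono[OF Lc, of "real t"] by (simp add: divide_le_eq)
      finally have "T t / Lc \<le> 1 + real t" by simp
      then show ?thesis using k(1) by simp
    qed
    finally have "real k \<le> ln (real t + 9)" by (simp add: ln_ge_iff)
    moreover have "1 \<le> ln (real t + 9)" using exp_le by (simp add: ln_ge_iff)
    ultimately show ?thesis by simp
  qed
  then have "8 * b * R \<le> 8 * b * (1/2 + l + 2 * ln (2 * ln (real t + 9)))"
    using b_pos by (intro mult_left_mono) (auto simp: R_def)
  with bound half show ?case by linarith
qed

text \<open>A union bound over the geometric horizons: outside all crossing events and the bad
  initial event, the deterministic induction applies to the path.\<close>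

lemma uniform_rate:
  assumes l: "l \<ge> 1" and Lc_ge: "Lc \<ge> 128 * b * l^2"
    and init: "prob {\<omega>\<in>space M. err 0 (\<lambda>i. Y i \<omega>) \<le> 1/4} \<ge> 1 - p"
  shows "prob {\<omega>\<in>space M. \<forall>t. T t * err t (\<lambda>i. Y i \<omega>)
      \<le> Lc / 4 + 8 * b * (1/2 + l + 2 * ln (2 * ln (real t + 9)))} \<ge> 1 - p - 3 * exp (- l)"
    (is "prob ?G \<ge> _")
proof -
  define H where "H k = 4^(k+1) * Lc" for k :: nat
  \<comment> \<open>The threshold is set so that the crossing probability becomes
    \<open>exp (- l) / (real k + 1)^2\<close>, summable in \<open>k\<close>.\<close>
  define a where "a k = exp (\<theta> (H k) 0 / 4 + l + 2 * ln (real k + 1))" for k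
  \<comment> \<open>\<open>N k\<close> is the last time \<open>s\<close> with
    \<open>T s \<le> H k\<close>.\<close>
  define N where "N k = nat \<lfloor>H k - Lc\<rfloor>" for k
  have H_ge: "H k \<ge> Lc" for k
    using Lc one_le_power[of "4::real" "k+1"] by (simp add: H_def)
  have N: "s \<le> N k \<longleftrightarrow> T s \<le> H k" for s k
    using H_ge[of k] by (simp add: N_def T_def le_nat_floor le_nat_iff le_floor_iff algebra_simps)
  define E where "E k = {\<omega>\<in>space M. \<exists>s\<le>N k. (err 0 (\<lambda>i. Y i \<omega>) \<le> 1/4 \<and> (\<forall>r<s. err r (\<lambda>i. Y i \<omega>) \<le> 1/2))
      \<and> a k \<le> pot (H k) s (\<lambda>i. Y i \<omega>)}" for k
  define I where "I = {\<omega>\<in>space M. err 0 (\<lambda>i. Y i \<omega>) \<le> 1/4}"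
  have [measurable]: "E k \<in> sets M" "I \<in> sets M" for k unfolding E_def I_def by measurable
  have G[measurable]: "?G \<in> sets M" by measurable
  have E_prob: "prob (E k) \<le> exp (- l) / (real k + 1)^2" for k
  proof -
    have "emeasure M (E k) \<le> ennreal (exp (\<theta> (H k) 0 / 4) / a k)"
      unfolding E_def by (rule pot_crossing) (use N[of "N k" k] in \<open>auto simp: a_def\<close>)
    moreover have "exp (2 * ln (real k + 1)) = (real k + 1)^2" by (simp add: exp_double)
    then have "a k = exp (\<theta> (H k) 0 / 4) * exp l * (real k + 1)^2" by (simp only: a_def exp_add)
    then have "exp (\<theta> (H k) 0 / 4) / a k = exp (- l) / (real k + 1)^2"
      by (simp add: exp_minus divide_simps)
    ultimately show ?thesis by (simp add: emeasure_eq_measure)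
  qed
  have sums: "(\<lambda>k. exp (- l) * (1 / (real k + 1)^2)) sums (exp (- l) * (pi^2 / 6))"
    using inverse_squares_sums by (intro sums_mult) (simp add: add.commute)
  have summ: "summable (\<lambda>k. prob (E k))"
    by (rule summable_comparison_test[OF _ sums_summable[OF sums]]) (use E_prob in auto)
  have "prob (\<Union>k. E k) \<le> (\<Sum>k. prob (E k))"
    by (rule finite_measure_subadditive_countably) (use summ in auto)
  also have "\<dots> \<le> (\<Sum>k. exp (- l) * (1 / (real k + 1)^2))"
    by (rule suminf_le) (use E_prob summ sums_summable[OF sums] in auto)
  also have "\<dots> = exp (- l) * (pi^2 / 6)" using sums by (rule sums_unique[symmetric])
  also have "\<dots> \<le> exp (- l) * 3"
  proof -
    \<comment> \<open>The crude bound 16/6 for the sum of inverse squares stays below 3.\<close>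
    have "pi^2 \<le> 4^2" using pi_less_4 by (intro power_mono) auto
    then show ?thesis by (intro mult_left_mono) auto
  qed
  finally have UE: "prob (\<Union>k. E k) \<le> 3 * exp (- l)" by simp
  have "I - (\<Union>k. E k) \<subseteq> ?G"
  proof
    fix \<omega> assume \<omega>: "\<omega> \<in> I - (\<Union>k. E k)"
    have "err t (\<lambda>i. Y i \<omega>) \<le> 1/2 \<and> T t * err t (\<lambda>i. Y i \<omega>)
       \<le> Lc / 4 + 8 * b * (1/2 + l + 2 * ln (2 * ln (real t + 9)))" for t
    proof (rule err_bound_if_no_crossing[OF l Lc_ge])
      show "err 0 (\<lambda>i. Y i \<omega>) \<le> 1/4" using \<omega> by (simp add: I_def)
      fix k s assume s: "T s \<le> 4^(k+1) * Lc" and half: "\<And>r. r < s \<Longrightarrow> err r (\<lambda>i. Y i \<omega>) \<le> 1/2"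
      have "s \<le> N k" using s by (simp only: N H_def)
      moreover have "\<omega> \<notin> E k" using \<omega> by auto
      ultimately have "\<not> a k \<le> pot (H k) s (\<lambda>i. Y i \<omega>)"
        using \<omega> half unfolding E_def I_def by blast
      then show "pot (4^(k+1) * Lc) s (\<lambda>i. Y i \<omega>)
         < exp (\<theta> (4^(k+1) * Lc) 0 / 4 + l + 2 * ln (real k + 1))"
        by (simp only: H_def a_def not_le)
    qed
    then show "\<omega> \<in> ?G" using \<omega> by (auto simp: I_def)
  qed
  then have "prob (I - (\<Union>k. E k)) \<le> prob ?G" by (rule finite_measure_mono) fact
  moreover have "prob I \<le> prob ((I - (\<Union>k. E k)) \<union> (\<Union>k. E k))"
    by (rule finite_measure_mono) auto
  then have "prob I \<le> prob (I - (\<Union>k. E k)) + prob (\<Union>k. E k)"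
    using measure_Un_le[of "I - (\<Union>k. E k)" M "\<Union>k. E k"] by auto
  ultimately show ?thesis using UE init by (simp add: I_def)
qed

end

section \<open>The degenerate case of zero data and the final assembly\<close>

lemma cov_matrix_eq_0:
  assumes "AE \<omega> in M. Y \<omega> = 0"
  shows "cov_matrix M Y = 0"
proof -
  have "(\<integral>\<omega>. Y \<omega> $ i * Y \<omega> $ j \<partial>M) = 0" for i j
    using assms by (intro integral_eq_zero_AE) (auto elim!: eventually_mono)
  then show ?thesis by (simp add: cov_matrix_def vec_eq_iff)
qed

text \<open>Rules out \<open>B = 0\<close>: every vector is an eigenvector of the zero matrix, so
  its top eigenspace is the whole space and there is no gap in dimension at least 2.\<close>

lemma lambda2_zero_matrix:
  assumes "CARD('n) \<ge> 2"
  shows "lambda2 (0 :: real^'n^'n) = lambda1 (0 :: real^'n^'n)"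
proof -
  obtain x :: "real^'n" where "x \<noteq> 0" by (rule that[of "axis undefined 1"]) simp
  then have "eigvals (0 :: real^'n^'n) = {0}" by (auto simp: eigvals_def)
  then have "lambda1 (0 :: real^'n^'n) = 0" by (simp add: lambda1_def)
  moreover from this have "eigspace (0 :: real^'n^'n) (lambda1 (0 :: real^'n^'n)) = UNIV"
    by (simp add: eigspace_def)
  ultimately show ?thesis using assms by (simp add: lambda2_def)
qed

theorem theorem3:
  fixes M :: "'a measure"
    and X :: "nat \<Rightarrow> 'a \<Rightarrow> real^'n"
    and v0 :: "'a \<Rightarrow> real^'n"
    and B \<rho> \<delta> Lc :: real
    and v1 :: "real^'n"
    and \<eta> :: "nat \<Rightarrow> real"
  assumes M: "prob_space M"
    and dimp: "CARD('n) \<ge> 2"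
    and meas: "\<And>t. X t \<in> borel_measurable M" "v0 \<in> borel_measurable M"
    and indep: "prob_space.indep_vars M (\<lambda>_. borel) (\<lambda>t. if t = 0 then v0 else X t) UNIV"
    and ident: "\<And>t. t \<ge> 1 \<Longrightarrow> distr M borel (X t) = distr M borel (X 1)"
    and centered: "\<And>t. t \<ge> 1 \<Longrightarrow> integral\<^sup>L M (X t) = 0"
    and bounded: "\<And>t. t \<ge> 1 \<Longrightarrow> AE \<omega> in M. norm (X t \<omega>) \<le> B"
    and gap: "lambda2 (cov_matrix M (X 1)) < lambda1 (cov_matrix M (X 1))"
    and v1: "norm v1 = 1" "cov_matrix M (X 1) *v v1 = lambda1 (cov_matrix M (X 1)) *\<^sub>R v1"
    and rho: "\<rho> = lambda1 (cov_matrix M (X 1)) - lambda2 (cov_matrix M (X 1))"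
    and unit: "AE \<omega> in M. norm (v0 \<omega>) = 1"
    and delta: "0 < \<delta>" "\<delta> < 1"
    and init: "measure M {\<omega> \<in> space M. sin2 (v0 \<omega>) v1 \<le> 1/4} \<ge> 1 - \<delta>^3"
    and Lc: "Lc = max (real_of_int \<lceil>128 * B^4 * (ln (1/\<delta>))^2 / \<rho>^2\<rceil>) 32"
    and eta: "\<And>t. \<eta> t = 2 / (\<rho> * (real t + Lc))"
  shows "measure M {\<omega> \<in> space M. \<forall>t::nat.
            sin2 (kooja \<eta> (\<lambda>s. X s \<omega>) (v0 \<omega>) t) v1
              \<le> max (252 * Lc / ln (1/\<delta>)) (1008 * B^4 / \<rho>^2)
                 * (ln (1/\<delta>) + 2 * ln (ln (real t + 9))) / (real t + Lc)}
         \<ge> 1 - 2 * (exp 1 + 1) * \<delta>"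
proof (cases "ln (1/\<delta>) \<ge> 1")
  \<comment> \<open>Here \<open>exp 1 * \<delta>\<close> is at least 1, so the claimed probability
    bound is nonpositive.\<close>
  case False
  then have "1/\<delta> < exp 1"
    using delta by (metis exp_less_mono exp_ln not_le zero_less_divide_1_iff)
  then have "1 \<le> exp 1 * \<delta>" using delta by (simp add: field_simps)
  then have "1 - 2 * (exp 1 + 1) * \<delta> \<le> 0" using delta by (simp add: algebra_simps)
  then show ?thesis by (rule order_trans) simp
next
  case l: True
  interpret prob_space M by fact
  define l where "l = ln (1/\<delta>)"
  define Y where "Y = (\<lambda>t. if t = 0 then v0 else X t)"
  define D where "D = distr M borel (X 1)"
  note meas[measurable]
  have cov: "cov_matrix D (\<lambda>x. x) = cov_matrix M (X 1)"
    unfolding D_def by (rule cov_matrix_distr) (rule meas)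
  have bndD: "AE x in D. norm x \<le> B"
    unfolding D_def using bounded[of 1] by (subst AE_distr_iff) auto
  have "B \<ge> 0"
  proof -
    have "AE \<omega> in M. 0 \<le> B"
      using bounded[of 1, OF le_refl] by eventually_elim (meson norm_ge_zero order_trans)
    then show ?thesis by simp
  qed
  moreover have "B \<noteq> 0"
  proof
    assume "B = 0"
    then have "cov_matrix M (X 1) = 0"
      using bounded[of 1] by (intro cov_matrix_eq_0) auto
    with gap lambda2_zero_matrix[OF dimp] show False by simp
  qed
  ultimately have "B > 0" by simp
  have Lc32: "Lc \<ge> 32" by (simp add: Lc)
  interpret S: oja_stream M Y D B \<rho> Lc v1 \<eta>
  proof unfold_locales
    show "indep_vars (\<lambda>_. borel) Y UNIV" using indep unfolding Y_def .
    show "distr M borel (Y t) = D" if "t \<ge> 1" for t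
      using ident[OF that] that by (simp add: Y_def D_def)
    show "1 \<le> Lc" using Lc32 by simp
  qed (unfold cov, fact+)
  have err: "S.err t (\<lambda>i. Y i \<omega>) = sin2 (kooja \<eta> (\<lambda>s. X s \<omega>) (v0 \<omega>) t) v1" for t \<omega>
    unfolding S.err_def by (simp add: Y_def kooja_cong[of t "\<lambda>i. Y i \<omega>" "\<lambda>s. X s \<omega>", unfolded Y_def])
  have l1: "l \<ge> 1" using l by (simp add: l_def)
  have Lb: "Lc \<ge> 128 * S.b * l^2"
  proof -
    have "128 * S.b * l^2 = 128 * B^4 * (ln (1/\<delta>))^2 / \<rho>^2" by (simp add: S.b_def l_def)
    also have "\<dots> \<le> real_of_int \<lceil>128 * B^4 * (ln (1/\<delta>))^2 / \<rho>^2\<rceil>" by (rule le_of_int_ceiling)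
    also have "\<dots> \<le> Lc" by (simp add: Lc)
    finally show ?thesis .
  qed
  have "prob {\<omega>\<in>space M. S.err 0 (\<lambda>i. Y i \<omega>) \<le> 1/4} \<ge> 1 - \<delta>^3"
    using init by (simp add: err)
  note S.uniform_rate[OF l1 Lb this]
  also have "prob {\<omega>\<in>space M. \<forall>t. S.T t * S.err t (\<lambda>i. Y i \<omega>)
      \<le> Lc / 4 + 8 * S.b * (1/2 + l + 2 * ln (2 * ln (real t + 9)))}
    \<le> prob {\<omega> \<in> space M. \<forall>t::nat.
            sin2 (kooja \<eta> (\<lambda>s. X s \<omega>) (v0 \<omega>) t) v1
              \<le> max (252 * Lc / ln (1/\<delta>)) (1008 * B^4 / \<rho>^2)
                 * (ln (1/\<delta>) + 2 * ln (ln (real t + 9))) / (real t + Lc)}"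
  proof (rule finite_measure_mono)
    show "{\<omega> \<in> space M. \<forall>t::nat.
            sin2 (kooja \<eta> (\<lambda>s. X s \<omega>) (v0 \<omega>) t) v1
              \<le> max (252 * Lc / ln (1/\<delta>)) (1008 * B^4 / \<rho>^2)
                 * (ln (1/\<delta>) + 2 * ln (ln (real t + 9))) / (real t + Lc)} \<in> sets M"
      unfolding err[symmetric] by measurable
    \<comment> \<open>Conversion to the stated form through
      \<open>252 * Lc / l * (l + 2 * m)\<close>; the constants leave ample room.\<close>
    have key: "e \<le> max (252 * Lc / ln (1/\<delta>)) (1008 * B^4 / \<rho>^2)
                 * (ln (1/\<delta>) + 2 * ln (ln (real t + 9))) / (real t + Lc)"
      if "S.T t * e \<le> Lc / 4 + 8 * S.b * (1/2 + l + 2 * ln (2 * ln (real t + 9)))" for t e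
    proof -
      define m where "m = ln (ln (real t + 9))"
      have ln9: "1 \<le> ln (real t + 9)" using exp_le by (simp add: ln_ge_iff)
      have m0: "m \<ge> 0" using ln9 by (simp add: m_def)
      have "ln (2 * ln (real t + 9)) = ln 2 + m" using ln9 by (simp add: m_def ln_mult)
      also have "\<dots> \<le> 1 + m" using ln_2_less_1 by simp
      finally have "8 * S.b * (1/2 + l + 2 * ln (2 * ln (real t + 9))) \<le> 8 * S.b * (5/2 + l + 2 * m)"
        using S.b_pos by (intro mult_left_mono) auto
      also have "\<dots> = 20 * S.b + 8 * (S.b * l) + 16 * (S.b * m)" by (simp add: algebra_simps)
      also have "\<dots> \<le> 28 * (S.b * l^2) + 16 * (S.b * l * m)"
      proof -
        have "l \<le> l^2" "1 \<le> l^2" using l1 by (simp_all add: self_le_power one_le_power)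
        then have "S.b * 1 \<le> S.b * l^2" "S.b * l \<le> S.b * l^2" using S.b_pos by (auto intro!: mult_left_mono)
        moreover have "(S.b * m) * 1 \<le> (S.b * m) * l" using l1 S.b_pos m0 by (intro mult_left_mono) auto
        ultimately show ?thesis by (simp add: mult_ac)
      qed
      \<comment> \<open>\<open>128 * b * l^2 \<le> Lc\<close> dominates both terms; the iterated
        logarithm carries one power of \<open>l\<close> less, hence the division by
        \<open>l\<close>.\<close>
      also have "\<dots> \<le> Lc + Lc * m / l"
      proof -
        have "S.b * l^2 \<ge> 0" using S.b_pos by simp
        then have "28 * (S.b * l^2) \<le> Lc" and "16 * (S.b * l^2) \<le> Lc" using Lb by linarith+
        then have "16 * (S.b * l^2) * (m / l) \<le> Lc * (m / l)"
          using m0 l1 by (intro mult_right_mono) auto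
        moreover have "16 * (S.b * l^2) * (m / l) = 16 * (S.b * l * m)"
          using l1 by (simp add: power2_eq_square)
        ultimately show ?thesis using \<open>28 * (S.b * l^2) \<le> Lc\<close> by simp
      qed
      finally have "8 * S.b * (1/2 + l + 2 * ln (2 * ln (real t + 9))) \<le> Lc + Lc * m / l" .
      moreover have "0 \<le> Lc * m / l" using Lc32 m0 l1 by simp
      ultimately have "S.T t * e \<le> 252 * Lc + 504 * (Lc * m / l)"
        using that Lc32 by linarith
      also have "\<dots> = 252 * Lc / l * (l + 2 * m)" using l1 by (simp add: field_simps)
      also have "\<dots> \<le> max (252 * Lc / l) (1008 * B^4 / \<rho>^2) * (l + 2 * m)"
        using l1 m0 by (intro mult_right_mono) auto
      finally show ?thesis using S.T_ge(3)[of t]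
        by (simp add: l_def m_def S.T_def pos_le_divide_eq mult.commute)
    qed
    show "{\<omega>\<in>space M. \<forall>t. S.T t * S.err t (\<lambda>i. Y i \<omega>)
      \<le> Lc / 4 + 8 * S.b * (1/2 + l + 2 * ln (2 * ln (real t + 9)))}
     \<subseteq> {\<omega> \<in> space M. \<forall>t::nat.
            sin2 (kooja \<eta> (\<lambda>s. X s \<omega>) (v0 \<omega>) t) v1
              \<le> max (252 * Lc / ln (1/\<delta>)) (1008 * B^4 / \<rho>^2)
                 * (ln (1/\<delta>) + 2 * ln (ln (real t + 9))) / (real t + Lc)}"
      using key unfolding err by blast
  qed
  finally have main: "1 - \<delta>^3 - 3 * exp (- l) \<le> prob {\<omega> \<in> space M. \<forall>t::nat.
            sin2 (kooja \<eta> (\<lambda>s. X s \<omega>) (v0 \<omega>) t) v1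
              \<le> max (252 * Lc / ln (1/\<delta>)) (1008 * B^4 / \<rho>^2)
                 * (ln (1/\<delta>) + 2 * ln (ln (real t + 9))) / (real t + Lc)}" .
  \<comment> \<open>The failure budget is \<open>\<delta>^3 + 3 * \<delta>\<close>, at most
    \<open>4 * \<delta>\<close>, which fits since \<open>exp 1\<close> is at least 1.\<close>
  have "exp (- l) = \<delta>" using delta by (simp add: l_def ln_div)
  moreover have "\<delta>^3 \<le> \<delta>" using delta power_decreasing[of 1 3 \<delta>] by simp
  moreover have "1 * \<delta> \<le> exp 1 * \<delta>" using delta by (intro mult_right_mono) auto
  ultimately have "1 - 2 * (exp 1 + 1) * \<delta> \<le> 1 - \<delta>^3 - 3 * exp (- l)"
    by (simp add: algebra_simps)
  then show ?thesis using main by (rule order_trans)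
qed

end
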